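(* Let $X\in L^1_{loc}(\mathbb{R}^d)$ and $x_0\in\mathbb{R}^d$, and let $$p_0(x_0)=\sup\{p\ge 1: X \text{ belongs to } L^p \text{ in a neighborhood of } x_0\}\in[1,+\infty].$$ The function $p\mapsto h_p(x_0)$ (the $p$-exponent of $X$ at $x_0$) is defined on $[1,p_0(x_0))$, and possibly also at $p_0(x_0)$ (namely when $X$ belongs to $L^{p_0(x_0)}$ in a neighborhood of $x_0$), and on its domain of definition it satisfies: 1. it takes values in $\left[-\frac{d}{p_0(x_0)},\infty\right]$; 2. it is a decreasing (in the wide sense, i.e. non-increasing) function of $p$; 3. the function $r\mapsto h_{1/r}(x_0)$, defined for those $r\in[0,1]$ such that $1/r$ is in the domain of $p\mapsto h_p(x_0)$, is concave. Furthermore, these conditions are optimal: if $p_0\in(1,\infty)$ and $\phi$ is a function defined on $[1,p_0]$ such that $\phi$ takes values in $[-d/p_0,\infty]$, $\phi$ is decreasing (in the wide sense), and $r\mapsto\phi(1/r)$ is concave on $[1/p_0,1]$, then there exists $X\in L^{p_0}(\mathbb{R}^d)$ such that $$\forall p\in[1,p_0],\qquad h_p(x_0)=\phi(p).$$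
   Context: Let $1\le p<\infty$, let $X$ be a function that belongs to $L^p$ in a neighborhood of $x_0\in\mathbb{R}^d$, and let $\alpha>-d/p$. One says that $X\in T^p_\alpha(x_0)$ if there exist a constant $C$ and a polynomial $P_{x_0}$ of degree less than $\alpha$ ($P_{x_0}=0$ if $\alpha\le 0$) such that, for all $a>0$ small enough, $$\left(\frac1{a^d}\int_{B(0,a)}|X(u+x_0)-P_{x_0}(u+x_0)|^p\,du\right)^{1/p}\le C a^\alpha ,$$ where $B(0,a)$ is the ball of radius $a$ centered at $0$. For $p=\infty$ the left-hand side is replaced by the $L^\infty$ norm of $X-P_{x_0}$ on the ball $B(x_0,a)$, with $\alpha\geq 0$ (this is the usual Hölder condition). The $p$-exponent of $X$ at $x_0$ is $$h_p(x_0)=\sup\{\alpha: X\in T^p_\alpha(x_0)\}\in[-d/p,+\infty].$$ The value $\alpha=-d/p$ (with $P_{x_0}=0$) is always admissible when $X$ is in $L^p$ near $x_0$, so $h_p(x_0)=-d/p$ when no $\alpha>-d/p$ is admissible. Conventions: $1/0=\infty$, $d/\infty=0$; concavity of functions with values in $(-\infty,+\infty]$ is meant in the usual extended-real sense. *)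

theory Defs
  imports "HOL-Analysis.Analysis" "HOL-Probability.Essential_Supremum"
begin

text \<open>
  Exponents \<open>p\<close> live in \<^typ>\<open>ereal\<close>, so that \<open>p = \<infinity>\<close> is an ordinary exponent;
  the library's conventions \<open>1 / 0 = \<infinity>\<close> and \<open>d / \<infinity> = 0\<close> are the intended ones.
  The ambient space is \<open>real ^ 'd\<close>, of dimension \<open>CARD('d)\<close>.
\<close>

definition Lp :: "ereal \<Rightarrow> (real ^ 'd) set \<Rightarrow> (real ^ 'd \<Rightarrow> real) set" where
  "Lp p S = {X. X \<in> borel_measurable (lebesgue_on S) \<and>
     (if p = \<infinity> then esssup (lebesgue_on S) (\<lambda>x. ereal \<bar>X x\<bar>) < \<infinity>
      else integrable (lebesgue_on S) (\<lambda>x. \<bar>X x\<bar> powr real_of_ereal p))}"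

definition L1_loc :: "(real ^ 'd \<Rightarrow> real) set" where
  "L1_loc = {X. \<forall>K. compact K \<longrightarrow> X absolutely_integrable_on K}"

definition Lp_near :: "ereal \<Rightarrow> real ^ 'd \<Rightarrow> (real ^ 'd \<Rightarrow> real) set" where
  "Lp_near p x0 = {X. \<exists>U. open U \<and> x0 \<in> U \<and> X \<in> Lp p U}"

text \<open>
  Real polynomial functions in the coordinates of \<open>x\<close>, of total degree less than \<open>\<alpha>\<close>;
  \<open>k\<close> ranges over multi-indices. For \<open>\<alpha> \<le> 0\<close> there is no such multi-index and only
  the zero polynomial is left.
\<close>

definition polys_deg_less :: "real \<Rightarrow> (real ^ 'd \<Rightarrow> real) set" where
  "polys_deg_less \<alpha> = range (\<lambda>(c :: ('d \<Rightarrow> nat) \<Rightarrow> real) x.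
     \<Sum>k | real (\<Sum>i\<in>UNIV. k i) < \<alpha>. c k * (\<Prod>i\<in>UNIV. (x $ i) ^ k i))"

text \<open>The summation over multi-indices is a genuine finite sum.\<close>

lemma finite_multi_indices: "finite {k :: 'd::finite \<Rightarrow> nat. real (\<Sum>i\<in>UNIV. k i) < \<alpha>}"
proof (rule finite_subset)
  show "{k :: 'd \<Rightarrow> nat. real (\<Sum>i\<in>UNIV. k i) < \<alpha>} \<subseteq> UNIV \<rightarrow>\<^sub>E {..nat \<lceil>\<alpha>\<rceil>}"
  proof (clarsimp simp: PiE_iff)
    fix k :: "'d \<Rightarrow> nat" and i
    assume "(\<Sum>j\<in>UNIV. real (k j)) < \<alpha>"
    moreover have "real (k i) \<le> (\<Sum>j\<in>UNIV. real (k j))"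
      by (rule member_le_sum) auto
    ultimately show "k i \<le> nat \<lceil>\<alpha>\<rceil>" by linarith
  qed
  show "finite ((UNIV :: 'd set) \<rightarrow>\<^sub>E {..nat \<lceil>\<alpha>\<rceil>})" by (rule finite_PiE) auto
qed

text \<open>
  The normalised local \<open>L\<^sup>p\<close> norm. It is only used for functions that are in \<open>L\<^sup>p\<close> on
  small balls around \<open>x0\<close>, where the Bochner integral does not degenerate.
\<close>

definition local_norm :: "ereal \<Rightarrow> real ^ 'd \<Rightarrow> real \<Rightarrow> (real ^ 'd \<Rightarrow> real) \<Rightarrow> ereal" where
  "local_norm p x0 a Y =
     (if p = \<infinity> then esssup (lebesgue_on (ball x0 a)) (\<lambda>x. ereal \<bar>Y x\<bar>)
      else ereal ((1 / a ^ CARD('d) *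
             (LINT u|lebesgue_on (ball 0 a). \<bar>Y (u + x0)\<bar> powr real_of_ereal p))
           powr (1 / real_of_ereal p)))"

definition T_space :: "ereal \<Rightarrow> real \<Rightarrow> real ^ 'd \<Rightarrow> (real ^ 'd \<Rightarrow> real) set" where
  "T_space p \<alpha> x0 = {X. X \<in> Lp_near p x0 \<and>
     (\<exists>C. \<exists>P \<in> polys_deg_less \<alpha>. \<forall>\<^sub>F a in at_right 0.
        local_norm p x0 a (\<lambda>x. X x - P x) \<le> ereal (C * a powr \<alpha>))}"

text \<open>
  The supremum includes the value \<open>\<alpha> = -d/p\<close>, which is always admissible (with \<open>P = 0\<close>) for
  \<open>X\<close> in \<open>L\<^sup>p\<close> near \<open>x0\<close>. For \<open>p = \<infinity>\<close> the constraint reads \<open>\<alpha> \<ge> 0\<close>.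
\<close>

definition p_exponent :: "ereal \<Rightarrow> real ^ 'd \<Rightarrow> (real ^ 'd \<Rightarrow> real) \<Rightarrow> ereal" where
  "p_exponent p x0 X =
     Sup {ereal \<alpha> |\<alpha>. - (ereal (real CARD('d)) / p) \<le> ereal \<alpha> \<and> X \<in> T_space p \<alpha> x0}"

definition exponent_domain :: "real ^ 'd \<Rightarrow> (real ^ 'd \<Rightarrow> real) \<Rightarrow> ereal set" where
  "exponent_domain x0 X = {p. 1 \<le> p \<and> X \<in> Lp_near p x0}"

definition critical_exponent :: "real ^ 'd \<Rightarrow> (real ^ 'd \<Rightarrow> real) \<Rightarrow> ereal" where
  "critical_exponent x0 X = Sup {p. 1 \<le> p \<and> X \<in> Lp_near p x0}"

text \<open>
  Concavity of functions with values in \<open>(-\<infinity>, \<infinity>]\<close>; the library's \<^const>\<open>concave_on\<close> is restricted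
  to real values. Since \<open>-\<infinity>\<close> is not a value, no sum \<open>\<infinity> - \<infinity>\<close> occurs, and \<open>0 * \<infinity> = 0\<close>.
\<close>

definition concave_on_ereal :: "real set \<Rightarrow> (real \<Rightarrow> ereal) \<Rightarrow> bool" where
  "concave_on_ereal S f \<longleftrightarrow> convex S \<and> (\<forall>x\<in>S. f x \<noteq> -\<infinity>) \<and>
     (\<forall>x\<in>S. \<forall>y\<in>S. \<forall>u\<ge>0. \<forall>v\<ge>0. u + v = 1 \<longrightarrow>
        ereal u * f x + ereal v * f y \<le> f (u * x + v * y))"

end

theory Submission
  imports Defs "HOL-Library.Discrete_Functions" "HOL-Real_Asymp.Real_Asymp"
begin

text \<open>
  Write \<open>d\<close> for the dimension and call \<open>\<integral>\<^sub>A \<bar>Y\<bar> powr p\<close> the \<open>p\<close>-energy of \<open>Y\<close> on \<open>A\<close>. For finite \<open>p\<close> the condition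
  \<open>X \<in> T\<^sup>p\<^sub>\<alpha>(x0)\<close> says that for some polynomial \<open>P\<close> of degree less than \<open>\<alpha>\<close> the \<open>p\<close>-energy of \<open>X - P\<close> on
  \<open>ball x0 a\<close> is \<open>O(a powr (d + \<alpha> * p))\<close>; this is the predicate \<open>decays\<close>, which also covers \<open>p = \<infinity>\<close>.

  \<^bold>\<open>Necessity.\<close> Everything rests on the pointwise inequality
  \<open>\<bar>y\<bar> powr s \<le> L powr (s - p) * \<bar>y\<bar> powr p + L powr (s - q) * \<bar>y\<bar> powr q\<close> for \<open>p \<le> s \<le> q\<close>, used with a power of
  \<open>a\<close> for the threshold \<open>L\<close>. For \<open>p = 0\<close> it shows that a decay rate for \<open>q\<close> is one for every smaller
  exponent, hence that the exponent decreases, and, applied to the rate \<open>- d / q\<close> that every function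
  in \<open>L\<^sup>q\<close> has, that it is at least \<open>- d / p\<^sub>0\<close>. For \<open>p > 0\<close> it interpolates two decay rates of one
  function, with rates affine in \<open>1 / s\<close>. Concavity follows once the polynomials \<open>P\<close> and \<open>Q\<close>
  attached to two exponents are known to agree up to a negligible term
  (\<open>polys_low_degree_part_vanishes\<close>): a polynomial whose energy is small at rate \<open>\<beta>\<close> has no terms of
  degree less than \<open>\<beta>\<close> in its expansion at \<open>x0\<close>, because its lowest homogeneous part is bounded below
  on a ball proportional to \<open>ball x0 a\<close>.

  \<^bold>\<open>Optimality.\<close> A bump of height \<open>a powr h\<close> on a ball of measure about \<open>a powr (d + g)\<close>, at distance \<open>a\<close> from
  \<open>x0\<close>, has \<open>p\<close>-energy \<open>a powr (d + p * (h + g / p))\<close>, that is, rate \<open>h + g * r\<close> with \<open>r = 1 / p\<close>: an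
  affine function of \<open>r\<close>, increasing since \<open>g \<ge> 0\<close>. Putting one bump at each distance \<open>2 powr (- n)\<close>, with
  parameters \<open>h n\<close> and \<open>g n\<close>, gives a function whose exponent is the lower limit of the affine functions
  \<open>h n + g n * r\<close>. An increasing concave function on \<open>{1 / p\<^sub>0..1}\<close>, possibly discontinuous at
  the left end or infinite to the right of it, is such a lower limit (\<open>concave_is_liminf_of_affine\<close>): take chords over intervals
  which sweep \<open>{1 / p\<^sub>0..1}\<close> repeatedly and shrink. Two details make this exact. The bumps carry weights
  \<open>(n + 1) powr (-2)\<close>, invisible to the rates, which make the energies summable even at the borderline rate
  \<open>- d / p\<^sub>0\<close>. And all bumps lie on one side of a hyperplane through \<open>x0\<close>, so that on the other side an
  approximating polynomial approximates \<open>0\<close> and therefore vanishes.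
\<close>

section \<open>Polynomials near a point\<close>

definition mdeg :: "('d::finite \<Rightarrow> nat) \<Rightarrow> nat" where
  "mdeg k = (\<Sum>i\<in>UNIV. k i)"

definition monomial :: "('d::finite \<Rightarrow> nat) \<Rightarrow> real ^ 'd \<Rightarrow> real" where
  "monomial k x = (\<Prod>i\<in>UNIV. (x $ i) ^ k i)"

lemma finite_mdeg: "finite {k :: 'd::finite \<Rightarrow> nat. real (mdeg k) < \<alpha>}"
  unfolding mdeg_def by (rule finite_multi_indices)

lemma polys_deg_less_iff:
  "P \<in> polys_deg_less \<alpha> \<longleftrightarrow> (\<exists>c. \<forall>x. P x = (\<Sum>k | real (mdeg k) < \<alpha>. c k * monomial k x))"
  unfolding polys_deg_less_def mdeg_def monomial_def by (auto simp: fun_eq_iff)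

lemma polys_lincomb:
  assumes "finite K" "\<And>k. k \<in> K \<Longrightarrow> f k \<in> polys_deg_less \<alpha>"
  shows "(\<lambda>x. \<Sum>k\<in>K. c k * f k x) \<in> polys_deg_less \<alpha>"
proof -
  have "\<exists>b. \<forall>k\<in>K. \<forall>x. f k x = (\<Sum>j | real (mdeg j) < \<alpha>. b k j * monomial j x)"
    using assms(2) unfolding polys_deg_less_iff by metis
  then obtain b where b: "\<And>k x. k \<in> K \<Longrightarrow> f k x = (\<Sum>j | real (mdeg j) < \<alpha>. b k j * monomial j x)"
    by blast
  have "(\<Sum>k\<in>K. c k * f k x) = (\<Sum>j | real (mdeg j) < \<alpha>. (\<Sum>k\<in>K. c k * b k j) * monomial j x)" for x
  proof -
    have "(\<Sum>k\<in>K. c k * f k x) = (\<Sum>k\<in>K. \<Sum>j | real (mdeg j) < \<alpha>. c k * b k j * monomial j x)"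
      by (intro sum.cong refl) (simp add: b sum_distrib_left mult.assoc)
    also have "\<dots> = (\<Sum>j | real (mdeg j) < \<alpha>. (\<Sum>k\<in>K. c k * b k j) * monomial j x)"
      by (subst sum.swap) (simp add: sum_distrib_right)
    finally show ?thesis .
  qed
  then show ?thesis
    unfolding polys_deg_less_iff by (intro exI[of _ "\<lambda>j. \<Sum>k\<in>K. c k * b k j"] allI)
qed

lemma monomial_in_polys:
  assumes "real (mdeg k) < \<alpha>"
  shows "monomial k \<in> polys_deg_less \<alpha>"
  unfolding polys_deg_less_iff
proof (intro exI[of _ "\<lambda>j. if j = k then 1 else 0"] allI)
  fix x
  show "monomial k x = (\<Sum>j | real (mdeg j) < \<alpha>. (if j = k then 1 else 0) * monomial j x)"
    using assms finite_mdeg[of \<alpha>] by (subst sum.mono_neutral_cong_right[where S="{k}"]) auto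
qed

lemma zero_in_polys: "(\<lambda>x. 0) \<in> polys_deg_less \<alpha>"
  unfolding polys_deg_less_iff by (intro exI[of _ "\<lambda>_. 0"]) auto

lemma polys_diff:
  assumes "P \<in> polys_deg_less \<alpha>" "Q \<in> polys_deg_less \<alpha>"
  shows "(\<lambda>x. P x - Q x) \<in> polys_deg_less \<alpha>"
  using polys_lincomb[of "UNIV::bool set" "\<lambda>b. if b then P else Q" \<alpha> "\<lambda>b. if b then 1 else -1"] assms
  by (simp add: UNIV_bool)

lemma polys_mono:
  assumes "P \<in> polys_deg_less \<alpha>" "\<alpha> \<le> \<beta>"
  shows "P \<in> polys_deg_less \<beta>"
proof -
  from assms(1) obtain c where "\<And>x. P x = (\<Sum>k | real (mdeg k) < \<alpha>. c k * monomial k x)"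
    unfolding polys_deg_less_iff by blast
  then have "P = (\<lambda>x. \<Sum>k | real (mdeg k) < \<alpha>. c k * monomial k x)" by auto
  also have "\<dots> \<in> polys_deg_less \<beta>"
    using assms(2) by (intro polys_lincomb finite_mdeg monomial_in_polys) auto
  finally show ?thesis .
qed

text \<open>Expanding each factor \<open>(x\<^sub>i + t\<^sub>i) ^ k\<^sub>i\<close> by the binomial theorem only produces
  multi-indices below \<open>k\<close>.\<close>

lemma polys_translate:
  assumes "P \<in> polys_deg_less \<alpha>"
  shows "(\<lambda>x. P (x + t)) \<in> polys_deg_less \<alpha>"
proof -
  from assms obtain c where c: "\<And>x. P x = (\<Sum>k | real (mdeg k) < \<alpha>. c k * monomial k x)"
    unfolding polys_deg_less_iff by blast
  have mono: "(\<lambda>x. monomial k (x + t)) \<in> polys_deg_less \<alpha>" if k: "real (mdeg k) < \<alpha>" for k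
  proof -
    define b where "b g = (\<Prod>i\<in>UNIV. real (k i choose g i) * (t $ i) ^ (k i - g i))" for g
    have "monomial k (x + t) = (\<Sum>g\<in>PiE UNIV (\<lambda>i. {..k i}). b g * monomial g x)" for x
    proof -
      have "monomial k (x + t)
          = (\<Prod>i\<in>UNIV. \<Sum>j\<in>{..k i}. real (k i choose j) * (x $ i) ^ j * (t $ i) ^ (k i - j))"
        unfolding monomial_def by (simp add: binomial_ring)
      also have "\<dots> = (\<Sum>g\<in>PiE UNIV (\<lambda>i. {..k i}).
          \<Prod>i\<in>UNIV. real (k i choose g i) * (x $ i) ^ g i * (t $ i) ^ (k i - g i))"
        by (rule prod_sum_PiE) auto
      also have "\<dots> = (\<Sum>g\<in>PiE UNIV (\<lambda>i. {..k i}). b g * monomial g x)"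
        unfolding b_def monomial_def by (simp add: prod.distrib mult_ac)
      finally show ?thesis .
    qed
    moreover have "real (mdeg g) < \<alpha>" if "g \<in> PiE UNIV (\<lambda>i. {..k i})" for g
    proof -
      have "mdeg g \<le> mdeg k" unfolding mdeg_def using that by (intro sum_mono) auto
      with k show ?thesis by linarith
    qed
    ultimately show ?thesis
      by (simp only:) (intro polys_lincomb finite_PiE monomial_in_polys; simp)
  qed
  show ?thesis
    unfolding c using mono by (intro polys_lincomb finite_mdeg) auto
qed

lemma polys_expand:
  assumes "P \<in> polys_deg_less \<alpha>"
  shows "\<exists>c. \<forall>x. P x = (\<Sum>k | real (mdeg k) < \<alpha>. c k * monomial k (x - x0))"
proof -
  from polys_translate[OF assms, of x0] obtain c
    where "\<And>x. P (x + x0) = (\<Sum>k | real (mdeg k) < \<alpha>. c k * monomial k x)"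
    unfolding polys_deg_less_iff by blast
  from this[of "_ - x0"] show ?thesis by (intro exI[of _ c]) simp
qed

lemma monomial_abs_le:
  assumes "norm u \<le> a"
  shows "\<bar>monomial k u\<bar> \<le> a ^ mdeg k"
proof -
  have "\<bar>monomial k u\<bar> = (\<Prod>i\<in>UNIV. \<bar>u $ i\<bar> ^ k i)"
    unfolding monomial_def by (simp add: abs_prod power_abs)
  also have "\<dots> \<le> (\<Prod>i\<in>UNIV. a ^ k i)"
    using assms by (intro prod_mono conjI power_mono) (auto intro: order_trans[OF component_le_norm_cart])
  also have "\<dots> = a ^ mdeg k" unfolding mdeg_def by (simp add: power_sum)
  finally show ?thesis .
qed

lemma monomial_scale: "monomial k (t *\<^sub>R u) = t ^ mdeg k * monomial k u"
  unfolding monomial_def mdeg_def by (simp add: power_mult_distrib prod.distrib power_sum)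

lemma continuous_monomial: "continuous_on S (\<lambda>x. monomial k (f x))" if "continuous_on S f"
  unfolding monomial_def by (intro continuous_intros that)

lemma continuous_polys:
  assumes "P \<in> polys_deg_less \<alpha>" shows "continuous_on S P"
proof -
  from assms obtain c where c: "\<And>x. P x = (\<Sum>k | real (mdeg k) < \<alpha>. c k * monomial k x)"
    unfolding polys_deg_less_iff by blast
  show ?thesis unfolding c by (intro continuous_intros continuous_monomial)
qed

lemma monomials_high_degree_small:
  assumes "finite K" "\<And>k. k \<in> K \<Longrightarrow> \<beta> \<le> real (mdeg k)"
  shows "\<exists>M\<ge>0. \<forall>a u. 0 < a \<and> a \<le> 1 \<and> norm u \<le> a \<longrightarrow>
    \<bar>\<Sum>k\<in>K. c k * monomial k u\<bar> \<le> M * a powr \<beta>"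
proof (intro exI[of _ "\<Sum>k\<in>K. \<bar>c k\<bar>"] conjI allI impI sum_nonneg)
  fix a :: real and u :: "real ^ 'a"
  assume a: "0 < a \<and> a \<le> 1 \<and> norm u \<le> a"
  have "\<bar>\<Sum>k\<in>K. c k * monomial k u\<bar> \<le> (\<Sum>k\<in>K. \<bar>c k\<bar> * a powr \<beta>)"
  proof (rule sum_abs[THEN order_trans], rule sum_mono)
    fix k assume k: "k \<in> K"
    have "\<bar>monomial k u\<bar> \<le> a powr real (mdeg k)"
      using monomial_abs_le[of u a k] a by (simp add: powr_realpow)
    also have "\<dots> \<le> a powr \<beta>" using a assms(2)[OF k] by (intro powr_mono') auto
    finally show "\<bar>c k * monomial k u\<bar> \<le> \<bar>c k\<bar> * a powr \<beta>"
      by (simp add: abs_mult mult_left_mono)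
  qed
  then show "\<bar>\<Sum>k\<in>K. c k * monomial k u\<bar> \<le> (\<Sum>k\<in>K. \<bar>c k\<bar>) * a powr \<beta>"
    by (simp add: sum_distrib_right)
qed auto

text \<open>The terms of degree at least \<open>\<gamma>\<close> in the expansion at \<open>x0\<close> are \<open>O(a powr \<gamma>)\<close>. This is meant for \<open>\<gamma> \<le> 0\<close> as
  well, where \<open>R = 0\<close> and the bound is weaker than boundedness, as \<open>a \<le> 1\<close>.\<close>

lemma polys_truncate:
  fixes x0 :: "real ^ 'd"
  assumes "P \<in> polys_deg_less \<alpha>"
  obtains R M where "R \<in> polys_deg_less \<gamma>" "M \<ge> 0"
    "\<And>a x. 0 < a \<Longrightarrow> a \<le> 1 \<Longrightarrow> x \<in> ball x0 a \<Longrightarrow> \<bar>P x - R x\<bar> \<le> M * a powr \<gamma>"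
proof -
  obtain c where c: "\<And>x. P x = (\<Sum>k | real (mdeg k) < \<alpha>. c k * monomial k (x - x0))"
    using polys_expand[OF assms, of x0] by blast
  define A B where "A = {k :: 'd \<Rightarrow> nat. real (mdeg k) < \<alpha>}" and "B = {k :: 'd \<Rightarrow> nat. real (mdeg k) < \<gamma>}"
  define R where "R x = (\<Sum>k\<in>A \<inter> B. c k * monomial k (x - x0))" for x
  have fA: "finite A" unfolding A_def by (rule finite_mdeg)
  have "(\<lambda>x. \<Sum>k\<in>A \<inter> B. c k * monomial k x) \<in> polys_deg_less \<gamma>"
    using fA by (intro polys_lincomb monomial_in_polys) (auto simp: B_def)
  from polys_translate[OF this, of "-x0"] have R: "R \<in> polys_deg_less \<gamma>"
    unfolding R_def by simp
  obtain M where M: "M \<ge> 0" "\<And>a u. 0 < a \<Longrightarrow> a \<le> 1 \<Longrightarrow> norm u \<le> a \<Longrightarrow>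
      \<bar>\<Sum>k\<in>A - B. c k * monomial k u\<bar> \<le> M * a powr \<gamma>"
    using monomials_high_degree_small[of "A - B" \<gamma> c] fA by (auto simp: B_def)
  show ?thesis
  proof (rule that[OF R M(1)])
    fix a x assume a: "0 < a" "a \<le> 1" "x \<in> ball x0 a"
    have "P x - R x = (\<Sum>k\<in>A - B. c k * monomial k (x - x0))"
      unfolding c R_def A_def[symmetric]
      using sum.Int_Diff[OF fA, of "\<lambda>k. c k * monomial k (x - x0)" B] by simp
    with M(2)[of a "x - x0"] a show "\<bar>P x - R x\<bar> \<le> M * a powr \<gamma>"
      by (simp add: dist_norm norm_minus_commute)
  qed
qed

section \<open>Polynomials with small energy on half balls\<close>

definition energy :: "real \<Rightarrow> (real ^ 'd) set \<Rightarrow> (real ^ 'd \<Rightarrow> real) \<Rightarrow> ennreal" where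
  "energy p A Y = (\<integral>\<^sup>+x. ennreal (\<bar>Y x\<bar> powr p) \<partial>(lebesgue_on A))"

lemma energy_indicator:
  "A \<in> sets lebesgue \<Longrightarrow> energy p A Y = (\<integral>\<^sup>+x. ennreal (\<bar>Y x\<bar> powr p) * indicator A x \<partial>lebesgue)"
  unfolding energy_def by (simp add: nn_integral_restrict_space)

lemma emeasure_ball_cart:
  fixes x :: "real ^ 'd"
  assumes "0 \<le> r"
  shows "emeasure lebesgue (ball x r) = ennreal (unit_ball_vol (real CARD('d)) * r ^ CARD('d))"
  using emeasure_ball[OF assms, of x] by simp

lemma energy_ge:
  assumes "B \<in> sets lebesgue" "A \<in> sets lebesgue" "B \<subseteq> A" "0 \<le> m" "0 \<le> p" "\<And>x. x \<in> B \<Longrightarrow> m \<le> \<bar>Y x\<bar>"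
  shows "ennreal (m powr p) * emeasure lebesgue B \<le> energy p A Y"
proof -
  have "ennreal (m powr p) * emeasure lebesgue B = (\<integral>\<^sup>+x. ennreal (m powr p) * indicator B x \<partial>lebesgue)"
    using assms(1) by (subst nn_integral_cmult_indicator) auto
  also have "\<dots> \<le> energy p A Y"
    unfolding energy_indicator[OF assms(2)] using assms
    by (intro nn_integral_mono) (auto split: split_indicator intro!: ennreal_leI powr_mono2)
  finally show ?thesis .
qed

lemma eventually_at_right_small:
  "0 < c \<Longrightarrow> \<forall>\<^sub>F a in at_right (0::real). 0 < a \<and> a < c"
  by (rule eventually_mono[OF eventually_at_right_real[of 0 c]]) auto

lemma powr_not_dominated:
  fixes K C \<delta> :: real
  assumes "K > 0" "\<delta> > 0" "\<forall>\<^sub>F a in at_right 0. K * a powr s \<le> C * a powr (s + \<delta>)"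
  shows False
proof -
  have "((\<lambda>a. C * a powr \<delta>) \<longlongrightarrow> 0) (at_right 0)"
  proof -
    have "((\<lambda>a::real. C * a powr \<delta>) \<longlongrightarrow> C * (0 powr \<delta>)) (at_right 0)"
      using assms(2) by (intro tendsto_intros) (auto simp: eventually_at_filter)
    then show ?thesis using assms(2) by simp
  qed
  moreover have "\<forall>\<^sub>F a in at_right 0. K \<le> C * a powr \<delta>"
    using assms(3) eventually_at_right_less[of "0::real"]
  proof eventually_elim
    case (elim a)
    then have "K * a powr s \<le> C * a powr \<delta> * a powr s" by (simp add: powr_add mult_ac)
    with elim(2) show ?case by simp
  qed
  ultimately have "K \<le> 0" by (intro tendsto_lowerbound) auto
  with assms(1) show False by simp
qed

text \<open>Let \<open>H j\<close> be the homogeneous part of degree \<open>j\<close> of \<open>R\<close> at \<open>x0\<close>, and \<open>j\<close> the least degree for which it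
  does not vanish. Around some \<open>w\<close> in the open unit half ball \<open>\<bar>H j\<bar>\<close> is bounded below, so that by
  homogeneity \<open>\<bar>R\<bar>\<close> is at least of order \<open>a ^ j\<close> on the dilated ball \<open>ball (x0 + a *\<^sub>R w) (a * e)\<close>. This forces
  energy of order \<open>a powr (d + j * p)\<close>, hence \<open>j \<ge> \<beta>\<close>. A half ball suffices, which gives access to
  polynomials that are controlled on one side of a hyperplane only.\<close>

lemma polys_low_degree_part_vanishes:
  fixes x0 :: "real ^ 'd" and i :: 'd
  assumes R: "R \<in> polys_deg_less \<gamma>" and p: "0 < p"
    and small: "\<forall>\<^sub>F a in at_right 0. energy p (ball x0 a \<inter> {x. x0 $ i < x $ i}) R
                  \<le> ennreal (C * a powr (real CARD('d) + \<beta> * p))"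
  shows "\<exists>c. \<forall>x. R x = (\<Sum>k | real (mdeg k) < \<gamma> \<and> \<beta> \<le> real (mdeg k). c k * monomial k (x - x0))"
proof -
  let ?d = "CARD('d)"
  obtain c where c: "\<And>x. R x = (\<Sum>k | real (mdeg k) < \<gamma>. c k * monomial k (x - x0))"
    using polys_expand[OF R, of x0] by blast
  define A where "A = {k :: 'd \<Rightarrow> nat. real (mdeg k) < \<gamma>}"
  have fA: "finite A" unfolding A_def by (rule finite_mdeg)
  define H where "H j u = (\<Sum>k | k \<in> A \<and> mdeg k = j. c k * monomial k u)" for j u
  have low: "(\<Sum>k | k \<in> A \<and> mdeg k < n. c k * monomial k u) = (\<Sum>j<n. H j u)" for n u
  proof -
    have "(\<Sum>j<n. \<Sum>k | k \<in> {k \<in> A. mdeg k < n} \<and> mdeg k = j. c k * monomial k u)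
        = (\<Sum>k | k \<in> A \<and> mdeg k < n. c k * monomial k u)"
      using fA by (intro sum.group) auto
    moreover have "(\<Sum>j<n. H j u)
        = (\<Sum>j<n. \<Sum>k | k \<in> {k \<in> A. mdeg k < n} \<and> mdeg k = j. c k * monomial k u)"
      unfolding H_def by (intro sum.cong refl) auto
    ultimately show ?thesis by simp
  qed
  have H_scale: "H j (t *\<^sub>R u) = t ^ j * H j u" for j t u
    unfolding H_def by (simp add: monomial_scale sum_distrib_left mult_ac)
  have H_cont: "continuous_on S (H j)" for S j
    unfolding H_def by (intro continuous_intros continuous_monomial)
  have H_zero: "H j u = 0" if j: "real j < \<beta>" for j u
    using j
  proof (induction j arbitrary: u rule: less_induct)
    case (less j)
    show ?case
    proof (rule ccontr)
      assume "H j u \<noteq> 0"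
      have "\<exists>w. H j w \<noteq> 0 \<and> w $ i \<noteq> 0"
      proof (cases "u $ i = 0")
        case True
        have "open {v. H j v \<noteq> 0}"
          using open_Collect_neq[OF H_cont continuous_on_const, of j 0] by simp
        with \<open>H j u \<noteq> 0\<close> obtain e where e: "e > 0" "ball u e \<subseteq> {v. H j v \<noteq> 0}"
          unfolding open_contains_ball by blast
        let ?w = "u + (e / 2) *\<^sub>R axis i 1"
        have "?w \<in> ball u e" using e(1) by (simp add: dist_norm)
        with e True show ?thesis by (intro exI[of _ ?w]) (auto simp: axis_def)
      qed (use \<open>H j u \<noteq> 0\<close> in auto)
      then obtain w' where w': "H j w' \<noteq> 0" "w' $ i \<noteq> 0" by blast
      \<comment> \<open>As \<open>\<bar>H j\<bar>\<close> is even, a point on the wrong side of the hyperplane may be reflected; dividing by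
        \<open>1 + norm w'\<close> moves it into the open unit ball.\<close>
      define t where "t = sgn (w' $ i) / (1 + norm w')"
      have t: "t * w' $ i > 0" "t \<noteq> 0"
      proof -
        have "sgn (w' $ i) * w' $ i > 0" using w'(2) by (simp add: sgn_if)
        then show "t * w' $ i > 0" unfolding t_def
          by (simp add: add_pos_nonneg)
        then show "t \<noteq> 0" by auto
      qed
      define w where "w = t *\<^sub>R w'"
      have "norm w = norm w' / (1 + norm w')"
        using w'(2) unfolding w_def t_def by (simp add: sgn_if)
      also have "\<dots> < 1" by (simp add: divide_less_eq add_pos_nonneg)
      finally have w: "norm w < 1" "w $ i > 0" "H j w \<noteq> 0"
        using t w'(1) by (auto simp: w_def H_scale)
      define m where "m = \<bar>H j w\<bar> / 2"
      have m: "m > 0" using w(3) by (simp add: m_def)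
      have "open {v. m < \<bar>H j v\<bar>}"
        by (intro open_Collect_less continuous_intros H_cont)
      moreover have "open {v::real^'d. norm v < 1}" "open {v::real^'d. 0 < v $ i}"
        by (intro open_Collect_less continuous_intros)+
      ultimately have "open ({v. m < \<bar>H j v\<bar>} \<inter> {v. norm v < 1} \<inter> {v. 0 < v $ i})"
        by (intro open_Int)
      moreover have "w \<in> {v. m < \<bar>H j v\<bar>} \<inter> {v. norm v < 1} \<inter> {v. 0 < v $ i}"
        using w by (simp add: m_def)
      ultimately obtain e where e: "e > 0"
        "ball w e \<subseteq> {v. m < \<bar>H j v\<bar>} \<inter> {v. norm v < 1} \<inter> {v. 0 < v $ i}"
        unfolding open_contains_ball by blast
      obtain M where M: "M \<ge> 0" "\<And>a u. 0 < a \<Longrightarrow> a \<le> 1 \<Longrightarrow> norm u \<le> a \<Longrightarrow>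
        \<bar>\<Sum>k\<in>{k. k \<in> A \<and> j < mdeg k}. c k * monomial k u\<bar> \<le> M * a powr real (Suc j)"
        using monomials_high_degree_small[of "{k. k \<in> A \<and> j < mdeg k}" "real (Suc j)" c] fA by force
      have split: "R x = H j (x - x0) + (\<Sum>k\<in>{k. k \<in> A \<and> j < mdeg k}. c k * monomial k (x - x0))" for x
      proof -
        have "R x = (\<Sum>k | k \<in> A \<and> mdeg k < Suc j. c k * monomial k (x - x0))
          + (\<Sum>k | k \<in> A \<and> j < mdeg k. c k * monomial k (x - x0))"
          unfolding c A_def[symmetric] using fA
          by (subst sum.union_disjoint[symmetric]) (auto intro!: sum.cong)
        also have "(\<Sum>k | k \<in> A \<and> mdeg k < Suc j. c k * monomial k (x - x0)) = H j (x - x0)"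
          unfolding low using less by simp
        finally show ?thesis .
      qed
      define K where "K = (m / 2) powr p * (unit_ball_vol (real ?d) * e ^ ?d)"
      have K: "K > 0" unfolding K_def using m e(1) by simp
      have "\<forall>\<^sub>F a in at_right 0. K * a powr (real ?d + real j * p)
          \<le> \<bar>C\<bar> * a powr ((real ?d + real j * p) + (\<beta> - real j) * p)"
      proof -
        have pos: "0 < min 1 (m / (2 * M + 1))"
          using m M(1) by auto
        show ?thesis
          using eventually_at_right_small[OF pos] small
        proof eventually_elim
          case (elim a)
          then have a: "0 < a" "a \<le> 1" "M * a \<le> m / 2"
          proof -
            have "a * (2 * M + 1) < m" using elim(1) M(1) by (simp add: pos_less_divide_eq)
            then show "0 < a" "a \<le> 1" "M * a \<le> m / 2"
              using elim(1) by (auto simp: distrib_left mult_ac)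
          qed
          let ?B = "ball (x0 + a *\<^sub>R w) (a * e)"
          have sc: "x = x0 + a *\<^sub>R ((x - x0) /\<^sub>R a) \<and> (x - x0) /\<^sub>R a \<in> ball w e" if "x \<in> ball (x0 + a *\<^sub>R w) (a * e)" for x
          proof -
            have "a *\<^sub>R (w - (x - x0) /\<^sub>R a) = x0 + a *\<^sub>R w - x"
              using a by (simp add: algebra_simps)
            then have "norm (x0 + a *\<^sub>R w - x) = a * norm (w - (x - x0) /\<^sub>R a)"
              using a by (metis abs_of_pos norm_scaleR)
            with that a show ?thesis by (simp add: dist_norm)
          qed
          have "ennreal ((a ^ j * (m / 2)) powr p) * emeasure lebesgue ?B
              \<le> energy p (ball x0 a \<inter> {x. x0 $ i < x $ i}) R"
          proof (rule energy_ge)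
            show "?B \<subseteq> ball x0 a \<inter> {x. x0 $ i < x $ i}"
            proof
              fix x assume "x \<in> ?B"
              then obtain u where u: "x = x0 + a *\<^sub>R u" "u \<in> ball w e" using sc by blast
              then have "norm u < 1" "0 < u $ i" using e(2) by auto
              then show "x \<in> ball x0 a \<inter> {x. x0 $ i < x $ i}"
                using a u by (simp add: dist_norm)
            qed
            show "a ^ j * (m / 2) \<le> \<bar>R x\<bar>" if "x \<in> ?B" for x
            proof -
              from that obtain u where u: "x = x0 + a *\<^sub>R u" "u \<in> ball w e" using sc by blast
              then have nu: "norm u < 1" and Hu: "m < \<bar>H j u\<bar>" using e(2) by auto
              have "norm (x - x0) \<le> a" using a u(1) nu by simp
              from M(2)[OF a(1,2) this]
              have "\<bar>R x - H j (x - x0)\<bar> \<le> M * a powr real (Suc j)" unfolding split by simp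
              also have "a powr real (Suc j) = a ^ Suc j" using a(1) by (rule powr_realpow)
              also have "M * a ^ Suc j = a ^ j * (M * a)" by simp
              also have "\<dots> \<le> a ^ j * (m / 2)" using a by (intro mult_left_mono) auto
              finally have "\<bar>R x - H j (x - x0)\<bar> \<le> a ^ j * (m / 2)" .
              moreover have "\<bar>H j (x - x0)\<bar> = a ^ j * \<bar>H j u\<bar>"
                using u(1) a(1) by (simp add: H_scale abs_mult)
              moreover have "a ^ j * m \<le> a ^ j * \<bar>H j u\<bar>" using Hu a by (intro mult_left_mono) auto
              ultimately show ?thesis by linarith
            qed
          qed (use m p a(1) in \<open>auto intro!: sets.Int borel_open open_Collect_less continuous_intros\<close>)
          also have "\<dots> \<le> ennreal (C * a powr (real ?d + \<beta> * p))" by (rule elim)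
          also have "\<dots> \<le> ennreal (\<bar>C\<bar> * a powr (real ?d + \<beta> * p))"
            by (intro ennreal_leI mult_right_mono) auto
          finally have "ennreal ((a ^ j * (m / 2)) powr p * (unit_ball_vol (real ?d) * (a * e) ^ ?d))
              \<le> ennreal (\<bar>C\<bar> * a powr (real ?d + \<beta> * p))"
            using a(1) e(1) m emeasure_ball_cart[of "a * e" "x0 + a *\<^sub>R w"]
            by (simp add: ennreal_mult del: emeasure_completion)
          then have "(a ^ j * (m / 2)) powr p * (unit_ball_vol (real ?d) * (a * e) ^ ?d)
              \<le> \<bar>C\<bar> * a powr (real ?d + \<beta> * p)"
            by (subst (asm) ennreal_le_iff) auto
          also have "(a ^ j * (m / 2)) powr p * (unit_ball_vol (real ?d) * (a * e) ^ ?d)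
              = K * a powr (real ?d + real j * p)"
          proof -
            have "(a ^ j * (m / 2)) powr p = a powr (real j * p) * (m / 2) powr p"
              using a(1) m powr_mult[of "a ^ j" "m / 2" p] by (simp add: powr_powr flip: powr_realpow)
            moreover have "(a * e) ^ ?d = a powr real ?d * e ^ ?d"
              using a(1) by (simp add: power_mult_distrib powr_realpow)
            ultimately show ?thesis by (simp add: K_def powr_add mult_ac)
          qed
          finally show ?case by (simp add: algebra_simps)
        qed
      qed
      with K show False
        using less.prems p by (intro powr_not_dominated[of K "(\<beta> - real j) * p"]) auto
    qed
  qed
  have "R x = (\<Sum>k | real (mdeg k) < \<gamma> \<and> \<beta> \<le> real (mdeg k). c k * monomial k (x - x0))" for x
  proof -
    have lt: "n < nat \<lceil>\<beta>\<rceil> \<longleftrightarrow> real n < \<beta>" for n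
      by (simp add: zless_nat_eq_int_zless less_ceiling_iff)
    have "(\<Sum>k | k \<in> A \<and> real (mdeg k) < \<beta>. c k * monomial k (x - x0))
        = (\<Sum>k | k \<in> A \<and> mdeg k < nat \<lceil>\<beta>\<rceil>. c k * monomial k (x - x0))"
      by (simp only: lt)
    also have "\<dots> = 0"
      unfolding low by (intro sum.neutral ballI H_zero) (simp only: lessThan_iff lt)
    finally have zero: "(\<Sum>k | k \<in> A \<and> real (mdeg k) < \<beta>. c k * monomial k (x - x0)) = 0" .
    have "R x = (\<Sum>k\<in>A - {k. real (mdeg k) < \<beta>}. c k * monomial k (x - x0))"
      unfolding c A_def[symmetric]
      using sum.Int_Diff[OF fA, of "\<lambda>k. c k * monomial k (x - x0)" "{k. real (mdeg k) < \<beta>}"] zero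
      by (simp add: Int_def)
    also have "A - {k. real (mdeg k) < \<beta>} = {k. real (mdeg k) < \<gamma> \<and> \<beta> \<le> real (mdeg k)}"
      unfolding A_def by auto
    finally show ?thesis .
  qed
  then show ?thesis by blast
qed

section \<open>Comparing energies for different exponents\<close>

lemma powr_interpolate:
  fixes y L p s q :: real
  assumes "p \<le> s" "s \<le> q" "L > 0"
  shows "\<bar>y\<bar> powr s \<le> L powr (s - p) * \<bar>y\<bar> powr p + L powr (s - q) * \<bar>y\<bar> powr q"
proof (cases "y = 0")
  case False
  then have y: "\<bar>y\<bar> > 0" by simp
  consider "\<bar>y\<bar> \<le> L" | "L \<le> \<bar>y\<bar>" by linarith
  then show ?thesis
  proof cases
    case 1
    then have "\<bar>y\<bar> powr (s - p) * \<bar>y\<bar> powr p \<le> L powr (s - p) * \<bar>y\<bar> powr p"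
      using assms by (intro mult_right_mono powr_mono2) auto
    moreover have "\<bar>y\<bar> powr (s - p) * \<bar>y\<bar> powr p = \<bar>y\<bar> powr s" by (simp flip: powr_add)
    ultimately show ?thesis by (smt (verit) mult_nonneg_nonneg powr_ge_zero)
  next
    case 2
    then have "\<bar>y\<bar> powr (s - q) * \<bar>y\<bar> powr q \<le> L powr (s - q) * \<bar>y\<bar> powr q"
      using assms by (intro mult_right_mono powr_mono2') auto
    moreover have "\<bar>y\<bar> powr (s - q) * \<bar>y\<bar> powr q = \<bar>y\<bar> powr s" by (simp flip: powr_add)
    ultimately show ?thesis by (smt (verit) mult_nonneg_nonneg powr_ge_zero)
  qed
qed auto

lemma energy_interpolate:
  assumes Y: "Y \<in> borel_measurable (lebesgue_on A)" and "p \<le> s" "s \<le> q" "L > 0"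
  shows "energy s A Y \<le> ennreal (L powr (s - p)) * energy p A Y + ennreal (L powr (s - q)) * energy q A Y"
proof -
  note [measurable] = Y
  have "energy s A Y \<le> (\<integral>\<^sup>+x. ennreal (L powr (s - p)) * ennreal (\<bar>Y x\<bar> powr p)
      + ennreal (L powr (s - q)) * ennreal (\<bar>Y x\<bar> powr q) \<partial>(lebesgue_on A))"
    unfolding energy_def
    by (intro nn_integral_mono)
       (simp add: powr_interpolate assms ennreal_leI flip: ennreal_mult ennreal_plus)
  also have "\<dots> = ennreal (L powr (s - p)) * energy p A Y + ennreal (L powr (s - q)) * energy q A Y"
    unfolding energy_def by (simp add: nn_integral_add nn_integral_cmult)
  finally show ?thesis .
qed

lemma energy_mono:
  assumes "A \<subseteq> B" "A \<in> sets lebesgue" "B \<in> sets lebesgue"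
  shows "energy p A Y \<le> energy p B Y"
  unfolding energy_indicator[OF assms(2)] energy_indicator[OF assms(3)]
  using assms(1) by (intro nn_integral_mono) (auto split: split_indicator)

lemma energy_le_sup:
  assumes "A \<in> sets lebesgue" "AE x in lebesgue_on A. \<bar>Y x\<bar> \<le> M" "0 \<le> p"
  shows "energy p A Y \<le> ennreal (M powr p) * emeasure lebesgue A"
proof -
  have "energy p A Y \<le> (\<integral>\<^sup>+x. ennreal (M powr p) \<partial>(lebesgue_on A))"
    unfolding energy_def using assms(2)
    by (intro nn_integral_mono_AE) (auto elim!: eventually_mono intro!: ennreal_leI powr_mono2 assms(3))
  also have "\<dots> = ennreal (M powr p) * emeasure lebesgue A"
    using assms(1) by (simp add: emeasure_restrict_space)
  finally show ?thesis .
qed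

lemma energy_add_le:
  assumes X: "X \<in> borel_measurable (lebesgue_on A)" and Y: "Y \<in> borel_measurable (lebesgue_on A)"
    and p: "0 \<le> p"
  shows "energy p A (\<lambda>x. X x + Y x) \<le> ennreal (2 powr p) * (energy p A X + energy p A Y)"
proof -
  note [measurable] = X Y
  have *: "\<bar>x + y\<bar> powr p \<le> 2 powr p * (\<bar>x\<bar> powr p + \<bar>y\<bar> powr p)" for x y :: real
  proof -
    have "\<bar>x + y\<bar> powr p \<le> (2 * max \<bar>x\<bar> \<bar>y\<bar>) powr p" using p by (intro powr_mono2) auto
    also have "\<dots> = 2 powr p * (max \<bar>x\<bar> \<bar>y\<bar>) powr p" by (simp add: powr_mult)
    also have "\<dots> \<le> 2 powr p * (\<bar>x\<bar> powr p + \<bar>y\<bar> powr p)" by (simp add: max_def)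
    finally show ?thesis .
  qed
  have "energy p A (\<lambda>x. X x + Y x)
      \<le> (\<integral>\<^sup>+x. ennreal (2 powr p) * (ennreal (\<bar>X x\<bar> powr p) + ennreal (\<bar>Y x\<bar> powr p)) \<partial>(lebesgue_on A))"
    unfolding energy_def
    by (intro nn_integral_mono) (simp add: * ennreal_leI flip: ennreal_mult ennreal_plus)
  also have "\<dots> = ennreal (2 powr p) * (energy p A X + energy p A Y)"
    unfolding energy_def by (simp add: nn_integral_add nn_integral_cmult)
  finally show ?thesis .
qed

section \<open>Local decay rates\<close>

text \<open>The bound of the normalised \<open>L\<^sup>p\<close> norm by \<open>C * a powr \<beta>\<close>, raised to the power \<open>p\<close>, is a bound of the energy.
  In \<^typ>\<open>ennreal\<close> it needs no integrability; measurability is kept so that energies of sums can be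
  estimated.\<close>

definition decays :: "ereal \<Rightarrow> real \<Rightarrow> real ^ 'd \<Rightarrow> (real ^ 'd \<Rightarrow> real) \<Rightarrow> bool" where
  "decays p \<beta> x0 Y \<longleftrightarrow> (\<exists>C\<ge>0. \<forall>\<^sub>F a in at_right 0. Y \<in> borel_measurable (lebesgue_on (ball x0 a)) \<and>
     (if p = \<infinity> then AE x in lebesgue_on (ball x0 a). \<bar>Y x\<bar> \<le> C * a powr \<beta>
      else energy (real_of_ereal p) (ball x0 a) Y
             \<le> ennreal (C * a powr (real CARD('d) + \<beta> * real_of_ereal p))))"

lemma decaysE_real:
  fixes x0 :: "real ^ 'd"
  assumes "decays (ereal p) \<beta> x0 Y"
  obtains C where "C \<ge> 0" "\<forall>\<^sub>F a in at_right 0. Y \<in> borel_measurable (lebesgue_on (ball x0 a)) \<and>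
    energy p (ball x0 a) Y \<le> ennreal (C * a powr (real CARD('d) + \<beta> * p))"
  using assms unfolding decays_def by auto

lemma decaysI_real:
  fixes x0 :: "real ^ 'd"
  assumes "C \<ge> 0" "\<forall>\<^sub>F a in at_right 0. Y \<in> borel_measurable (lebesgue_on (ball x0 a)) \<and>
    energy p (ball x0 a) Y \<le> ennreal (C * a powr (real CARD('d) + \<beta> * p))"
  shows "decays (ereal p) \<beta> x0 Y"
  using assms unfolding decays_def by auto

lemma decaysE_infinity:
  assumes "decays \<infinity> \<beta> x0 Y"
  obtains C where "C \<ge> 1" "\<forall>\<^sub>F a in at_right 0. Y \<in> borel_measurable (lebesgue_on (ball x0 a)) \<and>
    (AE x in lebesgue_on (ball x0 a). \<bar>Y x\<bar> \<le> C * a powr \<beta>)"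
proof -
  from assms obtain C where C: "C \<ge> 0" "\<forall>\<^sub>F a in at_right 0. Y \<in> borel_measurable (lebesgue_on (ball x0 a)) \<and>
    (AE x in lebesgue_on (ball x0 a). \<bar>Y x\<bar> \<le> C * a powr \<beta>)" unfolding decays_def by auto
  have le: "y \<le> (C + 1) * a powr \<beta>" if "y \<le> C * a powr \<beta>" for y a
    using that powr_ge_zero[of a \<beta>] unfolding distrib_right by linarith
  show ?thesis
  proof (rule that[of "C + 1"])
    show "\<forall>\<^sub>F a in at_right 0. Y \<in> borel_measurable (lebesgue_on (ball x0 a)) \<and>
      (AE x in lebesgue_on (ball x0 a). \<bar>Y x\<bar> \<le> (C + 1) * a powr \<beta>)"
      using C(2) by eventually_elim (auto elim!: eventually_mono intro: le)
  qed (use C in auto)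
qed

lemma decaysI_infinity:
  assumes "C \<ge> 0" "\<forall>\<^sub>F a in at_right 0. Y \<in> borel_measurable (lebesgue_on (ball x0 a)) \<and>
    (AE x in lebesgue_on (ball x0 a). \<bar>Y x\<bar> \<le> C * a powr \<beta>)"
  shows "decays \<infinity> \<beta> x0 Y"
  using assms unfolding decays_def by auto

lemma ereal_exponent_cases:
  assumes "1 \<le> (p :: ereal)"
  obtains (real) r where "p = ereal r" "1 \<le> r" | (infinity) "p = \<infinity>"
  using assms by (cases p) auto

lemma decays_cmono:
  assumes "decays p \<beta> x0 Y" "\<alpha> \<le> \<beta>" "1 \<le> p"
  shows "decays p \<alpha> x0 Y"
  using \<open>1 \<le> p\<close>
proof (cases p rule: ereal_exponent_cases)
  case (real r)
  obtain C where C: "C \<ge> 0" "\<forall>\<^sub>F a in at_right 0. Y \<in> borel_measurable (lebesgue_on (ball x0 a)) \<and>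
    energy r (ball x0 a) Y \<le> ennreal (C * a powr (real CARD('a) + \<beta> * r))"
    using assms(1) unfolding real(1) by (rule decaysE_real)
  show ?thesis unfolding real(1)
  proof (rule decaysI_real[OF C(1)])
    show "\<forall>\<^sub>F a in at_right 0. Y \<in> borel_measurable (lebesgue_on (ball x0 a)) \<and>
      energy r (ball x0 a) Y \<le> ennreal (C * a powr (real CARD('a) + \<alpha> * r))"
      using C(2) eventually_at_right_small[OF zero_less_one]
    proof eventually_elim
      case (elim a)
      have "C * a powr (real CARD('a) + \<beta> * r) \<le> C * a powr (real CARD('a) + \<alpha> * r)"
        using elim C(1) assms(2) real(2) by (intro mult_left_mono powr_mono') auto
      with elim show ?case by (auto elim: order_trans intro: ennreal_leI)
    qed
  qed
next
  case infinity
  obtain C where C: "C \<ge> 1" "\<forall>\<^sub>F a in at_right 0. Y \<in> borel_measurable (lebesgue_on (ball x0 a)) \<and>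
    (AE x in lebesgue_on (ball x0 a). \<bar>Y x\<bar> \<le> C * a powr \<beta>)"
    using assms(1) unfolding infinity by (rule decaysE_infinity)
  show ?thesis unfolding infinity
  proof (rule decaysI_infinity[of C])
    show "\<forall>\<^sub>F a in at_right 0. Y \<in> borel_measurable (lebesgue_on (ball x0 a)) \<and>
      (AE x in lebesgue_on (ball x0 a). \<bar>Y x\<bar> \<le> C * a powr \<alpha>)"
      using C(2) eventually_at_right_small[OF zero_less_one]
    proof eventually_elim
      case (elim a)
      have "C * a powr \<beta> \<le> C * a powr \<alpha>"
        using elim C(1) assms(2) by (intro mult_left_mono powr_mono') auto
      with elim show ?case by (auto elim!: eventually_mono)
    qed
  qed (use C in auto)
qed

lemma decays_add:
  assumes "decays p \<beta> x0 X" "decays p \<beta> x0 Y" "1 \<le> p"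
  shows "decays p \<beta> x0 (\<lambda>x. X x + Y x)"
  using \<open>1 \<le> p\<close>
proof (cases p rule: ereal_exponent_cases)
  case (real r)
  obtain C where C: "C \<ge> 0" "\<forall>\<^sub>F a in at_right 0. X \<in> borel_measurable (lebesgue_on (ball x0 a)) \<and>
    energy r (ball x0 a) X \<le> ennreal (C * a powr (real CARD('a) + \<beta> * r))"
    using assms(1) unfolding real(1) by (rule decaysE_real)
  obtain D where D: "D \<ge> 0" "\<forall>\<^sub>F a in at_right 0. Y \<in> borel_measurable (lebesgue_on (ball x0 a)) \<and>
    energy r (ball x0 a) Y \<le> ennreal (D * a powr (real CARD('a) + \<beta> * r))"
    using assms(2) unfolding real(1) by (rule decaysE_real)
  show ?thesis unfolding real(1)
  proof (rule decaysI_real[of "2 powr r * (C + D)"])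
    show "\<forall>\<^sub>F a in at_right 0. (\<lambda>x. X x + Y x) \<in> borel_measurable (lebesgue_on (ball x0 a)) \<and>
      energy r (ball x0 a) (\<lambda>x. X x + Y x) \<le> ennreal (2 powr r * (C + D) * a powr (real CARD('a) + \<beta> * r))"
      using C(2) D(2)
    proof eventually_elim
      case (elim a)
      have "energy r (ball x0 a) (\<lambda>x. X x + Y x) \<le> ennreal (2 powr r) *
          (ennreal (C * a powr (real CARD('a) + \<beta> * r)) + ennreal (D * a powr (real CARD('a) + \<beta> * r)))"
        using elim real(2)
        by (intro energy_add_le[THEN order_trans] mult_left_mono add_mono) auto
      also have "\<dots> = ennreal (2 powr r * (C + D) * a powr (real CARD('a) + \<beta> * r))"
        using C(1) D(1) by (simp add: algebra_simps flip: ennreal_mult ennreal_plus)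
      finally show ?case using elim by auto
    qed
  qed (use C(1) D(1) in auto)
next
  case infinity
  obtain C where C: "C \<ge> 1" "\<forall>\<^sub>F a in at_right 0. X \<in> borel_measurable (lebesgue_on (ball x0 a)) \<and>
    (AE x in lebesgue_on (ball x0 a). \<bar>X x\<bar> \<le> C * a powr \<beta>)"
    using assms(1) unfolding infinity by (rule decaysE_infinity)
  obtain D where D: "D \<ge> 1" "\<forall>\<^sub>F a in at_right 0. Y \<in> borel_measurable (lebesgue_on (ball x0 a)) \<and>
    (AE x in lebesgue_on (ball x0 a). \<bar>Y x\<bar> \<le> D * a powr \<beta>)"
    using assms(2) unfolding infinity by (rule decaysE_infinity)
  show ?thesis unfolding infinity
  proof (rule decaysI_infinity[of "C + D"])
    show "\<forall>\<^sub>F a in at_right 0. (\<lambda>x. X x + Y x) \<in> borel_measurable (lebesgue_on (ball x0 a)) \<and>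
      (AE x in lebesgue_on (ball x0 a). \<bar>X x + Y x\<bar> \<le> (C + D) * a powr \<beta>)"
      using C(2) D(2)
    proof eventually_elim
      case (elim a)
      then have "AE x in lebesgue_on (ball x0 a). \<bar>X x\<bar> \<le> C * a powr \<beta>"
        "AE x in lebesgue_on (ball x0 a). \<bar>Y x\<bar> \<le> D * a powr \<beta>" by auto
      then have "AE x in lebesgue_on (ball x0 a). \<bar>X x + Y x\<bar> \<le> (C + D) * a powr \<beta>"
        by eventually_elim (simp add: distrib_right)
      with elim show ?case by auto
    qed
  qed (use C(1) D(1) in auto)
qed

lemma powr_scaled_powr:
  "0 \<le> M \<Longrightarrow> 0 < a \<Longrightarrow> (M * a powr \<beta>) powr p * (v * a ^ d) = M powr p * v * a powr (real d + \<beta> * p)"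
  for M a v :: real
  by (simp add: powr_mult powr_powr powr_add powr_realpow mult_ac)

lemma decays_of_bounded:
  fixes x0 :: "real ^ 'd"
  assumes "continuous_on UNIV Y" "0 \<le> M" "1 \<le> p"
    "\<And>a x. 0 < a \<Longrightarrow> a \<le> 1 \<Longrightarrow> x \<in> ball x0 a \<Longrightarrow> \<bar>Y x\<bar> \<le> M * a powr \<beta>"
  shows "decays p \<beta> x0 Y"
proof -
  have meas: "Y \<in> borel_measurable (lebesgue_on (ball x0 a))" for a
    by (intro continuous_imp_measurable_on_sets_lebesgue continuous_on_subset[OF assms(1)]) auto
  have AE: "AE x in lebesgue_on (ball x0 a). \<bar>Y x\<bar> \<le> M * a powr \<beta>" if "0 < a \<and> a < 1" for a
    using assms(4)[of a] that by (intro AE_I2) (auto simp: space_restrict_space)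
  show ?thesis
    using \<open>1 \<le> p\<close>
  proof (cases p rule: ereal_exponent_cases)
    case (real r)
    show ?thesis unfolding real(1)
    proof (rule decaysI_real[of "M powr r * unit_ball_vol (real CARD('d))"])
      show "\<forall>\<^sub>F a in at_right 0. Y \<in> borel_measurable (lebesgue_on (ball x0 a)) \<and>
        energy r (ball x0 a) Y
          \<le> ennreal (M powr r * unit_ball_vol (real CARD('d)) * a powr (real CARD('d) + \<beta> * r))"
        using eventually_at_right_small[OF zero_less_one]
      proof eventually_elim
        case (elim a)
        have "energy r (ball x0 a) Y \<le> ennreal ((M * a powr \<beta>) powr r) * emeasure lebesgue (ball x0 a)"
          using real(2) by (intro energy_le_sup AE elim) auto
        also have "\<dots> = ennreal ((M * a powr \<beta>) powr r * (unit_ball_vol (real CARD('d)) * a ^ CARD('d)))"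
          using emeasure_ball_cart[of a x0] elim by (simp add: ennreal_mult del: emeasure_completion)
        finally show ?case using elim assms(2) meas by (simp add: powr_scaled_powr)
      qed
    qed (use assms(2) in auto)
  next
    case infinity
    show ?thesis unfolding infinity
      using eventually_at_right_small[OF zero_less_one]
      by (intro decaysI_infinity[OF assms(2)]) (auto elim!: eventually_mono intro: meas AE)
  qed
qed

text \<open>Jensen's inequality for the normalised measure on a ball, up to a constant: the threshold
  \<open>L = a powr \<beta>\<close> separates the small values, which are bounded by \<open>L\<close>, from the large ones, where
  \<open>\<bar>y\<bar> powr p \<le> L powr (p - q) * \<bar>y\<bar> powr q\<close>.\<close>

lemma decays_antimono_exponent:
  fixes x0 :: "real ^ 'd"
  assumes "decays q \<beta> x0 Y" "1 \<le> p" "p \<le> q"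
  shows "decays p \<beta> x0 Y"
proof -
  have q: "1 \<le> q" using assms by simp
  from \<open>1 \<le> p\<close> show ?thesis
  proof (cases p rule: ereal_exponent_cases)
    case infinity
    with assms show ?thesis by simp
  next
    case (real r)
    from q show ?thesis
    proof (cases q rule: ereal_exponent_cases)
      case (real t)
      have rt: "r \<le> t" "1 \<le> r" using assms(2,3) \<open>p = ereal r\<close> real by auto
      obtain C where C: "C \<ge> 0" "\<forall>\<^sub>F a in at_right 0. Y \<in> borel_measurable (lebesgue_on (ball x0 a)) \<and>
        energy t (ball x0 a) Y \<le> ennreal (C * a powr (real CARD('d) + \<beta> * t))"
        using assms(1) unfolding real(1) by (rule decaysE_real)
      show ?thesis unfolding \<open>p = ereal r\<close>
      proof (rule decaysI_real[of "unit_ball_vol (real CARD('d)) + C"])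
        show "\<forall>\<^sub>F a in at_right 0. Y \<in> borel_measurable (lebesgue_on (ball x0 a)) \<and>
          energy r (ball x0 a) Y
            \<le> ennreal ((unit_ball_vol (real CARD('d)) + C) * a powr (real CARD('d) + \<beta> * r))"
          using C(2) eventually_at_right_small[OF zero_less_one]
        proof eventually_elim
          case (elim a)
          define L where "L = a powr \<beta>"
          have L: "L > 0" using elim by (simp add: L_def)
          have "energy 0 (ball x0 a) Y \<le> energy 0 (ball x0 a) (\<lambda>x. 1)"
            unfolding energy_def by (intro nn_integral_mono) (auto simp: powr_def)
          also have "\<dots> = emeasure lebesgue (ball x0 a)"
            unfolding energy_def by (simp add: emeasure_restrict_space)
          finally have E0: "energy 0 (ball x0 a) Y \<le> ennreal (unit_ball_vol (real CARD('d)) * a ^ CARD('d))"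
            using emeasure_ball_cart[of a x0] elim by (simp del: emeasure_completion)
          have "energy r (ball x0 a) Y
              \<le> ennreal (L powr (r - 0)) * energy 0 (ball x0 a) Y + ennreal (L powr (r - t)) * energy t (ball x0 a) Y"
            using elim rt L by (intro energy_interpolate) auto
          also have "\<dots> \<le> ennreal (L powr (r - 0)) * ennreal (unit_ball_vol (real CARD('d)) * a ^ CARD('d))
              + ennreal (L powr (r - t)) * ennreal (C * a powr (real CARD('d) + \<beta> * t))"
            using elim E0 by (intro add_mono mult_left_mono) auto
          also have "\<dots> = ennreal (L powr r * (unit_ball_vol (real CARD('d)) * a ^ CARD('d))
              + L powr (r - t) * (C * a powr (real CARD('d) + \<beta> * t)))"
            using elim C(1) by (simp flip: ennreal_mult ennreal_plus)
          also have "L powr r * (unit_ball_vol (real CARD('d)) * a ^ CARD('d))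
              + L powr (r - t) * (C * a powr (real CARD('d) + \<beta> * t))
              = (unit_ball_vol (real CARD('d)) + C) * a powr (real CARD('d) + \<beta> * r)"
          proof -
            have "L powr r * (unit_ball_vol (real CARD('d)) * a ^ CARD('d))
                = unit_ball_vol (real CARD('d)) * a powr (real CARD('d) + \<beta> * r)"
              using powr_scaled_powr[of 1 a \<beta> r "unit_ball_vol (real CARD('d))" "CARD('d)"] elim
              by (simp add: L_def)
            moreover have "L powr (r - t) * a powr (real CARD('d) + \<beta> * t) = a powr (real CARD('d) + \<beta> * r)"
              unfolding L_def powr_powr powr_add[symmetric] by (simp add: algebra_simps)
            ultimately show ?thesis by (simp add: algebra_simps)
          qed
          finally show ?case using elim by simp
        qed
      qed (use C(1) in auto)
    next
      case infinity
      obtain C where C: "C \<ge> 1" "\<forall>\<^sub>F a in at_right 0. Y \<in> borel_measurable (lebesgue_on (ball x0 a)) \<and>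
        (AE x in lebesgue_on (ball x0 a). \<bar>Y x\<bar> \<le> C * a powr \<beta>)"
        using assms(1) unfolding infinity by (rule decaysE_infinity)
      show ?thesis unfolding \<open>p = ereal r\<close>
      proof (rule decaysI_real[of "C powr r * unit_ball_vol (real CARD('d))"])
        show "\<forall>\<^sub>F a in at_right 0. Y \<in> borel_measurable (lebesgue_on (ball x0 a)) \<and>
          energy r (ball x0 a) Y
            \<le> ennreal (C powr r * unit_ball_vol (real CARD('d)) * a powr (real CARD('d) + \<beta> * r))"
          using C(2) eventually_at_right_small[OF zero_less_one]
        proof eventually_elim
          case (elim a)
          have "energy r (ball x0 a) Y \<le> ennreal ((C * a powr \<beta>) powr r) * emeasure lebesgue (ball x0 a)"
            using \<open>1 \<le> r\<close> elim by (intro energy_le_sup) auto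
          also have "\<dots> = ennreal ((C * a powr \<beta>) powr r * (unit_ball_vol (real CARD('d)) * a ^ CARD('d)))"
            using emeasure_ball_cart[of a x0] elim by (simp add: ennreal_mult del: emeasure_completion)
          finally show ?case using elim C(1) by (simp add: powr_scaled_powr)
        qed
      qed (use C(1) in auto)
    qed
  qed
qed

text \<open>Log-convexity of \<open>L\<^sup>p\<close> norms at the level of decay rates. Choosing the threshold \<open>a powr \<theta>\<close> so that
  both terms of the pointwise interpolation inequality scale alike replaces Hoelder's inequality. The
  hypotheses say that \<open>\<gamma>\<close> depends on \<open>1 / s\<close> affinely, interpolating \<open>\<alpha>\<close> at \<open>1 / p\<close> and \<open>\<beta>\<close> at \<open>1 / q\<close>.\<close>

lemma decays_interpolate_real:
  fixes x0 :: "real ^ 'd"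
  assumes Yp: "decays (ereal p) \<alpha> x0 Y" and Yq: "decays (ereal q) \<beta> x0 Y"
    and pq: "p < q" and w: "0 \<le> w" "w \<le> 1" and s: "s = (1 - w) * p + w * q"
    and \<gamma>: "\<gamma> * s = (1 - w) * (\<alpha> * p) + w * (\<beta> * q)"
  shows "decays (ereal s) \<gamma> x0 Y"
proof -
  obtain C where C: "C \<ge> 0" "\<forall>\<^sub>F a in at_right 0. Y \<in> borel_measurable (lebesgue_on (ball x0 a)) \<and>
    energy p (ball x0 a) Y \<le> ennreal (C * a powr (real CARD('d) + \<alpha> * p))"
    using Yp by (rule decaysE_real)
  obtain D where D: "D \<ge> 0" "\<forall>\<^sub>F a in at_right 0. Y \<in> borel_measurable (lebesgue_on (ball x0 a)) \<and>
    energy q (ball x0 a) Y \<le> ennreal (D * a powr (real CARD('d) + \<beta> * q))"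
    using Yq by (rule decaysE_real)
  define \<theta> where "\<theta> = (\<beta> * q - \<alpha> * p) / (q - p)"
  have sp: "s - p = w * (q - p)" "s - q = - ((1 - w) * (q - p))"
    unfolding s by (simp_all add: algebra_simps)
  have ps: "p \<le> s" "s \<le> q"
    using sp pq w mult_nonneg_nonneg[of w "q - p"] mult_nonneg_nonneg[of "1 - w" "q - p"] by linarith+
  have "\<theta> * (q - p) = \<beta> * q - \<alpha> * p" unfolding \<theta>_def using pq by simp
  then have "\<theta> * (s - p) = w * (\<beta> * q - \<alpha> * p)" "\<theta> * (s - q) = - ((1 - w) * (\<beta> * q - \<alpha> * p))"
    unfolding sp by (simp_all add: mult.left_commute[of \<theta>])
  then have e1: "\<theta> * (s - p) + (real CARD('d) + \<alpha> * p) = real CARD('d) + \<gamma> * s"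
    and e2: "\<theta> * (s - q) + (real CARD('d) + \<beta> * q) = real CARD('d) + \<gamma> * s"
    unfolding \<gamma> by (simp_all only:) (simp_all add: algebra_simps)
  show ?thesis
  proof (rule decaysI_real[of "C + D"])
    show "\<forall>\<^sub>F a in at_right 0. Y \<in> borel_measurable (lebesgue_on (ball x0 a)) \<and>
      energy s (ball x0 a) Y \<le> ennreal ((C + D) * a powr (real CARD('d) + \<gamma> * s))"
      using C(2) D(2) eventually_at_right_small[OF zero_less_one]
    proof eventually_elim
      case (elim a)
      define L where "L = a powr \<theta>"
      have L: "L > 0" using elim by (simp add: L_def)
      have "energy s (ball x0 a) Y
          \<le> ennreal (L powr (s - p)) * energy p (ball x0 a) Y + ennreal (L powr (s - q)) * energy q (ball x0 a) Y"
        using elim L ps by (intro energy_interpolate) auto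
      also have "\<dots> \<le> ennreal (L powr (s - p)) * ennreal (C * a powr (real CARD('d) + \<alpha> * p))
          + ennreal (L powr (s - q)) * ennreal (D * a powr (real CARD('d) + \<beta> * q))"
        using elim by (intro add_mono mult_left_mono) auto
      also have "\<dots> = ennreal (C * (L powr (s - p) * a powr (real CARD('d) + \<alpha> * p))
          + D * (L powr (s - q) * a powr (real CARD('d) + \<beta> * q)))"
        using C(1) D(1) by (simp add: mult_ac flip: ennreal_mult ennreal_plus)
      also have "\<dots> = ennreal ((C + D) * a powr (real CARD('d) + \<gamma> * s))"
        unfolding L_def powr_powr powr_add[symmetric] e1 e2 by (simp add: distrib_right)
      finally show ?case using elim by simp
    qed
  qed (use C(1) D(1) in auto)
qed

text \<open>The limiting case \<open>q = \<infinity>\<close>: here \<open>\<bar>y\<bar> powr s \<le> L powr (s - p) * \<bar>y\<bar> powr p\<close> with \<open>L\<close> the essential bound of \<open>Y\<close>.\<close>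

lemma decays_interpolate_infinity:
  fixes x0 :: "real ^ 'd"
  assumes Yp: "decays (ereal p) \<alpha> x0 Y" and Yq: "decays \<infinity> \<beta> x0 Y"
    and ps: "p \<le> s" and \<gamma>: "\<gamma> * s = \<alpha> * p + \<beta> * (s - p)"
  shows "decays (ereal s) \<gamma> x0 Y"
proof -
  obtain C where C: "C \<ge> 0" "\<forall>\<^sub>F a in at_right 0. Y \<in> borel_measurable (lebesgue_on (ball x0 a)) \<and>
    energy p (ball x0 a) Y \<le> ennreal (C * a powr (real CARD('d) + \<alpha> * p))"
    using Yp by (rule decaysE_real)
  obtain D where D: "D \<ge> 1" "\<forall>\<^sub>F a in at_right 0. Y \<in> borel_measurable (lebesgue_on (ball x0 a)) \<and>
    (AE x in lebesgue_on (ball x0 a). \<bar>Y x\<bar> \<le> D * a powr \<beta>)"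
    using Yq by (rule decaysE_infinity)
  show ?thesis
  proof (rule decaysI_real[of "D powr (s - p) * C"])
    show "\<forall>\<^sub>F a in at_right 0. Y \<in> borel_measurable (lebesgue_on (ball x0 a)) \<and>
      energy s (ball x0 a) Y \<le> ennreal (D powr (s - p) * C * a powr (real CARD('d) + \<gamma> * s))"
      using C(2) D(2) eventually_at_right_small[OF zero_less_one]
    proof eventually_elim
      case (elim a)
      define L where "L = D * a powr \<beta>"
      from elim have [measurable]: "Y \<in> borel_measurable (lebesgue_on (ball x0 a))" by simp
      have pt: "\<bar>y\<bar> powr s \<le> L powr (s - p) * \<bar>y\<bar> powr p" if "\<bar>y\<bar> \<le> L" for y
      proof (cases "y = 0")
        case False
        have "\<bar>y\<bar> powr s = \<bar>y\<bar> powr (s - p) * \<bar>y\<bar> powr p" by (simp flip: powr_add)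
        also have "\<dots> \<le> L powr (s - p) * \<bar>y\<bar> powr p"
          using that ps by (intro mult_right_mono powr_mono2) auto
        finally show ?thesis .
      qed auto
      have "AE x in lebesgue_on (ball x0 a). \<bar>Y x\<bar> \<le> L" using elim by (simp add: L_def)
      then have "AE x in lebesgue_on (ball x0 a).
          ennreal (\<bar>Y x\<bar> powr s) \<le> ennreal (L powr (s - p)) * ennreal (\<bar>Y x\<bar> powr p)"
        by eventually_elim (simp add: pt ennreal_leI flip: ennreal_mult)
      then have "energy s (ball x0 a) Y \<le> (\<integral>\<^sup>+x. ennreal (L powr (s - p)) * ennreal (\<bar>Y x\<bar> powr p)
            \<partial>(lebesgue_on (ball x0 a)))"
        unfolding energy_def by (rule nn_integral_mono_AE)
      also have "\<dots> = ennreal (L powr (s - p)) * energy p (ball x0 a) Y"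
        unfolding energy_def by (simp add: nn_integral_cmult)
      also have "\<dots> \<le> ennreal (L powr (s - p)) * ennreal (C * a powr (real CARD('d) + \<alpha> * p))"
        using elim by (intro mult_left_mono) auto
      also have "\<dots> = ennreal (D powr (s - p) * C * a powr (real CARD('d) + \<gamma> * s))"
        using C(1) D(1) elim unfolding L_def \<gamma>
        by (simp add: powr_mult powr_powr powr_add mult_ac flip: ennreal_mult)
      finally show ?case using elim by simp
    qed
  qed (use C(1) D(1) in auto)
qed

section \<open>The spaces in terms of decay rates\<close>

lemma lebesgue_distr_translate:
  fixes t :: "'a::euclidean_space"
  shows "distr lebesgue lebesgue (\<lambda>x. x + t) = lebesgue" "(\<lambda>x. x + t) \<in> lebesgue \<rightarrow>\<^sub>M lebesgue"
proof -
  have T: "(\<lambda>x. t + (\<Sum>j\<in>Basis. (1 * (x \<bullet> j)) *\<^sub>R j)) = (\<lambda>x::'a. x + t)"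
    by (simp add: euclidean_representation add.commute)
  show "(\<lambda>x. x + t) \<in> lebesgue \<rightarrow>\<^sub>M lebesgue"
    using lebesgue_affine_measurable[of "\<lambda>_. 1" t] unfolding T by simp
  show "distr lebesgue lebesgue (\<lambda>x. x + t) = lebesgue"
    using lebesgue_affine_euclidean[of "\<lambda>_. 1" t] unfolding T by (simp add: density_1)
qed

lemma local_integral_eq_energy:
  fixes x0 :: "real ^ 'd"
  assumes Y: "Y \<in> borel_measurable (lebesgue_on (ball x0 a))"
  shows "(LINT u|lebesgue_on (ball 0 a). \<bar>Y (u + x0)\<bar> powr r) = enn2real (energy r (ball x0 a) Y)"
proof -
  define f where "f x = (if x \<in> ball x0 a then Y x else 0)" for x
  have f[measurable]: "f \<in> borel_measurable lebesgue"
    using borel_measurable_if_I[OF Y] by (simp add: f_def[abs_def])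
  note [measurable] = lebesgue_distr_translate(2)
  have shift: "u + x0 \<in> ball x0 a \<longleftrightarrow> u \<in> ball 0 a" for u by (simp add: dist_norm)
  have "(\<lambda>u. f (u + x0)) \<in> borel_measurable lebesgue" by measurable
  then have "(\<lambda>u. f (u + x0)) \<in> borel_measurable (lebesgue_on (ball 0 a))"
    by (rule measurable_restrict_space1)
  then have m: "(\<lambda>u. Y (u + x0)) \<in> borel_measurable (lebesgue_on (ball 0 a))"
    by (rule measurable_cong[THEN iffD1, rotated]) (auto simp: f_def space_restrict_space dist_norm)
  have "(\<integral>\<^sup>+u. ennreal (\<bar>Y (u + x0)\<bar> powr r) \<partial>lebesgue_on (ball 0 a))
      = (\<integral>\<^sup>+u. ennreal (\<bar>f (u + x0)\<bar> powr r) \<partial>lebesgue)"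
    by (subst nn_integral_restrict_space)
       (auto intro!: nn_integral_cong simp: f_def shift indicator_def dist_norm)
  also have "\<dots> = (\<integral>\<^sup>+u. ennreal (\<bar>f u\<bar> powr r) \<partial>distr lebesgue lebesgue (\<lambda>u. u + x0))"
    by (subst nn_integral_distr) auto
  also have "\<dots> = energy r (ball x0 a) Y"
    unfolding lebesgue_distr_translate(1)
    by (subst energy_indicator) (auto intro!: nn_integral_cong simp: f_def indicator_def)
  finally show ?thesis
    using m by (subst integral_eq_nn_integral) auto
qed

lemma ex_small_radius:
  assumes "\<forall>\<^sub>F a in at_right (0::real). P a"
  obtains a where "0 < a" "P a"
proof -
  have "\<forall>\<^sub>F a in at_right (0::real). 0 < a \<and> P a"
    using assms eventually_at_right_less[of 0] by eventually_elim auto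
  from eventually_happens'[OF trivial_limit_at_right_real this] that show ?thesis by blast
qed

lemma Lp_near_of_decays:
  assumes "decays p \<beta> x0 Y" "1 \<le> p"
  shows "Y \<in> Lp_near p x0"
  using \<open>1 \<le> p\<close>
proof (cases p rule: ereal_exponent_cases)
  case (real r)
  obtain C where C: "C \<ge> 0" "\<forall>\<^sub>F a in at_right 0. Y \<in> borel_measurable (lebesgue_on (ball x0 a)) \<and>
    energy r (ball x0 a) Y \<le> ennreal (C * a powr (real CARD('a) + \<beta> * r))"
    using assms(1) unfolding real(1) by (rule decaysE_real)
  from C(2) obtain a where a: "0 < a" "Y \<in> borel_measurable (lebesgue_on (ball x0 a))"
    "energy r (ball x0 a) Y \<le> ennreal (C * a powr (real CARD('a) + \<beta> * r))"
    by (rule ex_small_radius) auto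
  note [measurable] = a(2)
  have "energy r (ball x0 a) Y < \<infinity>" using a(3) by (auto intro: le_less_trans)
  then have "integrable (lebesgue_on (ball x0 a)) (\<lambda>x. \<bar>Y x\<bar> powr r)"
    by (subst integrable_iff_bounded) (auto simp: energy_def)
  with a show ?thesis unfolding Lp_near_def Lp_def real(1)
    by (auto intro!: exI[of _ "ball x0 a"])
next
  case infinity
  obtain C where C: "C \<ge> 1" "\<forall>\<^sub>F a in at_right 0. Y \<in> borel_measurable (lebesgue_on (ball x0 a)) \<and>
    (AE x in lebesgue_on (ball x0 a). \<bar>Y x\<bar> \<le> C * a powr \<beta>)"
    using assms(1) unfolding infinity by (rule decaysE_infinity)
  from C(2) obtain a where a: "0 < a" "Y \<in> borel_measurable (lebesgue_on (ball x0 a))"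
    "AE x in lebesgue_on (ball x0 a). \<bar>Y x\<bar> \<le> C * a powr \<beta>"
    by (rule ex_small_radius) auto
  note [measurable] = a(2)
  have "esssup (lebesgue_on (ball x0 a)) (\<lambda>x. ereal \<bar>Y x\<bar>) \<le> ereal (C * a powr \<beta>)"
    using a(3) by (intro esssup_I) auto
  then have "esssup (lebesgue_on (ball x0 a)) (\<lambda>x. ereal \<bar>Y x\<bar>) < \<infinity>"
    by (rule le_less_trans) simp
  with a show ?thesis unfolding Lp_near_def Lp_def infinity
    by (auto intro!: exI[of _ "ball x0 a"])
qed

text \<open>The rate at which the energy is merely bounded.\<close>

lemma decays_of_Lp_near_real:
  fixes x0 :: "real ^ 'd"
  assumes "X \<in> Lp_near (ereal r) x0" "1 \<le> r"
  shows "decays (ereal r) (- (real CARD('d) / r)) x0 X"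
proof -
  from assms(1) obtain U where U: "open U" "x0 \<in> U" "X \<in> borel_measurable (lebesgue_on U)"
    "integrable (lebesgue_on U) (\<lambda>x. \<bar>X x\<bar> powr r)" unfolding Lp_near_def Lp_def by auto
  from U obtain e where e: "e > 0" "ball x0 e \<subseteq> U" unfolding open_contains_ball by blast
  have fin: "energy r U X < \<infinity>" using U(4) by (simp add: integrable_iff_bounded energy_def)
  show ?thesis
  proof (rule decaysI_real[of "enn2real (energy r U X)"])
    show "\<forall>\<^sub>F a in at_right 0. X \<in> borel_measurable (lebesgue_on (ball x0 a)) \<and> energy r (ball x0 a) X
        \<le> ennreal (enn2real (energy r U X) * a powr (real CARD('d) + - (real CARD('d) / r) * r))"
      using eventually_at_right_small[OF e(1)]
    proof eventually_elim
      case (elim a)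
      then have "ball x0 a \<subseteq> U" using e(2) by auto
      moreover from this have "energy r (ball x0 a) X \<le> energy r U X"
        using U(1) by (intro energy_mono) auto
      ultimately show ?case
        using elim assms(2) fin U(3) by (auto intro: measurable_restrict_mono)
    qed
  qed auto
qed

lemma decays_of_Lp_near_infinity:
  assumes "X \<in> Lp_near \<infinity> x0"
  shows "decays \<infinity> 0 x0 X"
proof -
  from assms obtain U where U: "open U" "x0 \<in> U" "X \<in> borel_measurable (lebesgue_on U)"
    "esssup (lebesgue_on U) (\<lambda>x. ereal \<bar>X x\<bar>) < \<infinity>" unfolding Lp_near_def Lp_def by auto
  from U obtain e where e: "e > 0" "ball x0 e \<subseteq> U" unfolding open_contains_ball by blast
  define M where "M = max 0 (real_of_ereal (esssup (lebesgue_on U) (\<lambda>x. ereal \<bar>X x\<bar>)))"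
  have "AE x in lebesgue_on U. ereal \<bar>X x\<bar> \<le> esssup (lebesgue_on U) (\<lambda>x. ereal \<bar>X x\<bar>)"
    by (rule esssup_AE)
  then have AE: "AE x in lebesgue_on U. \<bar>X x\<bar> \<le> M"
  proof eventually_elim
    case (elim x)
    with U(4) show ?case
      by (cases "esssup (lebesgue_on U) (\<lambda>x. ereal \<bar>X x\<bar>)") (auto simp: M_def)
  qed
  show ?thesis
  proof (rule decaysI_infinity[of M])
    show "\<forall>\<^sub>F a in at_right 0. X \<in> borel_measurable (lebesgue_on (ball x0 a)) \<and>
        (AE x in lebesgue_on (ball x0 a). \<bar>X x\<bar> \<le> M * a powr 0)"
      using eventually_at_right_small[OF e(1)]
    proof eventually_elim
      case (elim a)
      then have sub: "ball x0 a \<subseteq> U" using e(2) by auto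
      have "AE x in lebesgue_on (ball x0 a). \<bar>X x\<bar> \<le> M"
        using AE sub U(1) by (auto simp: AE_restrict_space_iff elim!: eventually_mono)
      with sub elim U(3) show ?case by (auto intro: measurable_restrict_mono)
    qed
  qed (simp add: M_def)
qed

lemma decays_uminus: "decays p \<beta> x0 (\<lambda>x. - Y x) \<longleftrightarrow> decays p \<beta> x0 Y"
  unfolding decays_def energy_def by simp

lemma decays_diff:
  "decays p \<beta> x0 X \<Longrightarrow> decays p \<beta> x0 Y \<Longrightarrow> 1 \<le> p \<Longrightarrow> decays p \<beta> x0 (\<lambda>x. X x - Y x)"
  using decays_add[of p \<beta> x0 X "\<lambda>x. - Y x"] by (simp add: decays_uminus)

lemma polys_nonpos_degree: "P \<in> polys_deg_less \<alpha> \<Longrightarrow> \<alpha> \<le> 0 \<Longrightarrow> P x = 0"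
  unfolding polys_deg_less_iff by auto

lemma polys_decays_nonpos:
  assumes "P \<in> polys_deg_less \<alpha>" "\<beta> \<le> 0" "1 \<le> p"
  shows "decays p \<beta> x0 P"
proof -
  obtain R M where R: "R \<in> polys_deg_less \<beta>" "M \<ge> 0"
    "\<And>a x. 0 < a \<Longrightarrow> a \<le> 1 \<Longrightarrow> x \<in> ball x0 a \<Longrightarrow> \<bar>P x - R x\<bar> \<le> M * a powr \<beta>"
    using polys_truncate[OF assms(1)] by metis
  then have "\<And>a x. 0 < a \<Longrightarrow> a \<le> 1 \<Longrightarrow> x \<in> ball x0 a \<Longrightarrow> \<bar>P x\<bar> \<le> M * a powr \<beta>"
    using assms(2) by (simp add: polys_nonpos_degree)
  with R(2) assms show ?thesis
    by (intro decays_of_bounded[of _ M] continuous_polys) auto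
qed

text \<open>A common rate \<open>\<beta> \<le> 0\<close> serves for both summands, as polynomials are locally bounded.\<close>

lemma Lp_near_add_poly:
  assumes "(\<lambda>x. X x - P x) \<in> Lp_near p x0" "P \<in> polys_deg_less \<alpha>" "1 \<le> p"
  shows "X \<in> Lp_near p x0"
proof -
  have "\<exists>\<beta>\<le>0. decays p \<beta> x0 (\<lambda>x. X x - P x)"
    using \<open>1 \<le> p\<close>
  proof (cases p rule: ereal_exponent_cases)
    case (real r)
    with decays_of_Lp_near_real[of _ r x0] assms(1) show ?thesis
      by (intro exI[of _ "- (real CARD('a) / r)"]) auto
  next
    case infinity
    with decays_of_Lp_near_infinity assms(1) show ?thesis by auto
  qed
  then obtain \<beta> where \<beta>: "\<beta> \<le> 0" "decays p \<beta> x0 (\<lambda>x. X x - P x)" by blast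
  with polys_decays_nonpos[OF assms(2) \<beta>(1) assms(3)] assms(3)
  have "decays p \<beta> x0 (\<lambda>x. (X x - P x) + P x)" by (intro decays_add)
  then show ?thesis using Lp_near_of_decays[of p \<beta> x0 X] assms(3) by simp
qed

lemma decays_measurable:
  assumes "decays p \<beta> x0 Y"
  shows "\<forall>\<^sub>F a in at_right 0. Y \<in> borel_measurable (lebesgue_on (ball x0 a))"
  using assms unfolding decays_def by (auto elim: eventually_mono)

lemma Lp_near_measurable:
  assumes "X \<in> Lp_near p x0" "1 \<le> p"
  shows "\<forall>\<^sub>F a in at_right 0. X \<in> borel_measurable (lebesgue_on (ball x0 a))"
  using \<open>1 \<le> p\<close>
proof (cases p rule: ereal_exponent_cases)
  case (real r)
  with assms show ?thesis by (intro decays_measurable[OF decays_of_Lp_near_real]) auto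
next
  case infinity
  with assms show ?thesis by (intro decays_measurable[OF decays_of_Lp_near_infinity]) auto
qed

lemma Lp_near_energy_finite:
  assumes "X \<in> Lp_near (ereal r) x0" "1 \<le> r"
  shows "\<forall>\<^sub>F a in at_right 0. energy r (ball x0 a) X < \<infinity>"
proof -
  obtain C where "C \<ge> 0" "\<forall>\<^sub>F a in at_right 0. X \<in> borel_measurable (lebesgue_on (ball x0 a)) \<and>
    energy r (ball x0 a) X \<le> ennreal (C * a powr (real CARD('a) + - (real CARD('a) / r) * r))"
    using decays_of_Lp_near_real[OF assms] by (rule decaysE_real)
  from this(2) show ?thesis by eventually_elim (auto intro: le_less_trans)
qed

lemma polys_measurable: "P \<in> polys_deg_less \<alpha> \<Longrightarrow> P \<in> borel_measurable (lebesgue_on (ball x0 a))"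
  by (intro continuous_imp_measurable_on_sets_lebesgue continuous_polys) auto

lemma Lp_near_minus_poly:
  assumes "X \<in> Lp_near p x0" "P \<in> polys_deg_less \<alpha>" "1 \<le> p"
  shows "(\<lambda>x. X x - P x) \<in> Lp_near p x0"
proof (rule Lp_near_add_poly)
  have "(\<lambda>x. 0 - P x) \<in> polys_deg_less \<alpha>" by (intro polys_diff zero_in_polys assms)
  then show "(\<lambda>x. - P x) \<in> polys_deg_less \<alpha>" by simp
qed (use assms in auto)

lemma T_space_iff_real:
  fixes x0 :: "real ^ 'd"
  assumes r: "1 \<le> r"
  shows "X \<in> T_space (ereal r) \<alpha> x0 \<longleftrightarrow> (\<exists>P \<in> polys_deg_less \<alpha>. decays (ereal r) \<alpha> x0 (\<lambda>x. X x - P x))"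
proof -
  let ?d = "CARD('d)"
  have key: "(\<exists>C. \<forall>\<^sub>F a in at_right 0. local_norm (ereal r) x0 a Y \<le> ereal (C * a powr \<alpha>))
      \<longleftrightarrow> decays (ereal r) \<alpha> x0 Y" if Y: "Y \<in> Lp_near (ereal r) x0" for Y
  proof -
    have meas: "\<forall>\<^sub>F a in at_right 0. Y \<in> borel_measurable (lebesgue_on (ball x0 a)) \<and>
        energy r (ball x0 a) Y < \<infinity> \<and> 0 < a"
      using Lp_near_measurable[OF Y] Lp_near_energy_finite[OF Y] r eventually_at_right_less[of "0::real"]
      by (auto simp: eventually_conj_iff)
    define E where "E a = enn2real (energy r (ball x0 a) Y)" for a
    have norm: "local_norm (ereal r) x0 a Y = ereal ((E a / a ^ ?d) powr (1 / r))"
      if "Y \<in> borel_measurable (lebesgue_on (ball x0 a))" for a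
      using that unfolding local_norm_def by (simp add: local_integral_eq_energy E_def)
    show ?thesis
    proof
      assume "\<exists>C. \<forall>\<^sub>F a in at_right 0. local_norm (ereal r) x0 a Y \<le> ereal (C * a powr \<alpha>)"
      then obtain C where C: "\<forall>\<^sub>F a in at_right 0. local_norm (ereal r) x0 a Y \<le> ereal (C * a powr \<alpha>)"
        by blast
      show "decays (ereal r) \<alpha> x0 Y"
      proof (rule decaysI_real[of "\<bar>C\<bar> powr r"])
        show "\<forall>\<^sub>F a in at_right 0. Y \<in> borel_measurable (lebesgue_on (ball x0 a)) \<and>
          energy r (ball x0 a) Y \<le> ennreal (\<bar>C\<bar> powr r * a powr (real ?d + \<alpha> * r))"
          using C meas
        proof eventually_elim
          case (elim a)
          have E0: "0 \<le> E a / a ^ ?d" using elim by (simp add: E_def)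
          have "(E a / a ^ ?d) powr (1 / r) \<le> C * a powr \<alpha>" using elim by (simp add: norm)
          also have "\<dots> \<le> \<bar>C\<bar> * a powr \<alpha>" by (intro mult_right_mono) auto
          finally have "((E a / a ^ ?d) powr (1 / r)) powr r \<le> (\<bar>C\<bar> * a powr \<alpha>) powr r"
            using r by (intro powr_mono2) auto
          moreover have "(e powr (1 / r)) powr r = e" if "0 \<le> e" for e
            using r that by (simp add: powr_powr)
          ultimately have "E a / a ^ ?d \<le> (\<bar>C\<bar> * a powr \<alpha>) powr r"
            using E0 by metis
          then have "E a \<le> (\<bar>C\<bar> * a powr \<alpha>) powr r * (1 * a ^ ?d)"
            using elim by (simp add: divide_le_eq)
          also have "\<dots> = \<bar>C\<bar> powr r * a powr (real ?d + \<alpha> * r)"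
            using elim by (subst powr_scaled_powr) auto
          finally have "ennreal (E a) \<le> ennreal (\<bar>C\<bar> powr r * a powr (real ?d + \<alpha> * r))"
            by (rule ennreal_leI)
          with elim show ?case by (simp add: E_def)
        qed
      qed auto
    next
      assume "decays (ereal r) \<alpha> x0 Y"
      then obtain C where C: "C \<ge> 0" "\<forall>\<^sub>F a in at_right 0. Y \<in> borel_measurable (lebesgue_on (ball x0 a)) \<and>
        energy r (ball x0 a) Y \<le> ennreal (C * a powr (real ?d + \<alpha> * r))"
        by (rule decaysE_real)
      have "\<forall>\<^sub>F a in at_right 0. local_norm (ereal r) x0 a Y \<le> ereal (C powr (1 / r) * a powr \<alpha>)"
        using C(2) meas
      proof eventually_elim
        case (elim a)
        have "E a \<le> C * a powr (real ?d + \<alpha> * r)"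
          using elim C(1) unfolding E_def by (intro enn2real_leI) auto
        also have "\<dots> = C * a powr (\<alpha> * r) * a ^ ?d"
          using elim by (simp add: powr_add powr_realpow mult_ac)
        finally have "E a / a ^ ?d \<le> C * a powr (\<alpha> * r)" using elim by (simp add: divide_le_eq)
        then have "(E a / a ^ ?d) powr (1 / r) \<le> (C * a powr (\<alpha> * r)) powr (1 / r)"
          using r elim by (intro powr_mono2) (auto simp: E_def)
        also have "\<dots> = C powr (1 / r) * a powr \<alpha>"
          using r C(1) by (simp add: powr_mult powr_powr)
        finally show ?case using elim by (simp add: norm)
      qed
      then show "\<exists>C. \<forall>\<^sub>F a in at_right 0. local_norm (ereal r) x0 a Y \<le> ereal (C * a powr \<alpha>)" by blast
    qed
  qed
  have r1: "1 \<le> ereal r" using r by simp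
  show ?thesis
  proof
    assume "X \<in> T_space (ereal r) \<alpha> x0"
    then obtain C P where X: "X \<in> Lp_near (ereal r) x0" and P: "P \<in> polys_deg_less \<alpha>"
      and C: "\<forall>\<^sub>F a in at_right 0. local_norm (ereal r) x0 a (\<lambda>x. X x - P x) \<le> ereal (C * a powr \<alpha>)"
      unfolding T_space_def by blast
    from key[OF Lp_near_minus_poly[OF X P r1]] C P
    show "\<exists>P \<in> polys_deg_less \<alpha>. decays (ereal r) \<alpha> x0 (\<lambda>x. X x - P x)" by blast
  next
    assume "\<exists>P \<in> polys_deg_less \<alpha>. decays (ereal r) \<alpha> x0 (\<lambda>x. X x - P x)"
    then obtain P where P: "P \<in> polys_deg_less \<alpha>" "decays (ereal r) \<alpha> x0 (\<lambda>x. X x - P x)" by blast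
    have near: "(\<lambda>x. X x - P x) \<in> Lp_near (ereal r) x0" by (rule Lp_near_of_decays[OF P(2) r1])
    from key[OF near] P Lp_near_add_poly[OF near P(1) r1]
    show "X \<in> T_space (ereal r) \<alpha> x0" unfolding T_space_def by blast
  qed
qed

lemma T_space_iff_infinity:
  "X \<in> T_space \<infinity> \<alpha> x0 \<longleftrightarrow> (\<exists>P \<in> polys_deg_less \<alpha>. decays \<infinity> \<alpha> x0 (\<lambda>x. X x - P x))"
proof
  assume "X \<in> T_space \<infinity> \<alpha> x0"
  then obtain C P where X: "X \<in> Lp_near \<infinity> x0" and P: "P \<in> polys_deg_less \<alpha>"
    and C: "\<forall>\<^sub>F a in at_right 0. local_norm \<infinity> x0 a (\<lambda>x. X x - P x) \<le> ereal (C * a powr \<alpha>)"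
    unfolding T_space_def by blast
  have "decays \<infinity> \<alpha> x0 (\<lambda>x. X x - P x)"
  proof (rule decaysI_infinity[of "\<bar>C\<bar>"])
    show "\<forall>\<^sub>F a in at_right 0. (\<lambda>x. X x - P x) \<in> borel_measurable (lebesgue_on (ball x0 a)) \<and>
        (AE x in lebesgue_on (ball x0 a). \<bar>X x - P x\<bar> \<le> \<bar>C\<bar> * a powr \<alpha>)"
      using C Lp_near_measurable[OF X]
    proof (rule eventually_elim2)
      fix a assume a: "local_norm \<infinity> x0 a (\<lambda>x. X x - P x) \<le> ereal (C * a powr \<alpha>)"
        "X \<in> borel_measurable (lebesgue_on (ball x0 a))"
      have "AE x in lebesgue_on (ball x0 a). \<bar>X x - P x\<bar> \<le> \<bar>C\<bar> * a powr \<alpha>"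
        using esssup_AE[of "\<lambda>x. ereal \<bar>X x - P x\<bar>" "lebesgue_on (ball x0 a)"]
      proof eventually_elim
        case (elim x)
        also have "esssup (lebesgue_on (ball x0 a)) (\<lambda>x. ereal \<bar>X x - P x\<bar>) \<le> ereal (C * a powr \<alpha>)"
          using a(1) by (simp add: local_norm_def)
        also have "\<dots> \<le> ereal (\<bar>C\<bar> * a powr \<alpha>)" by (simp add: mult_right_mono)
        finally show ?case by simp
      qed
      with a(2) polys_measurable[OF P] show "(\<lambda>x. X x - P x) \<in> borel_measurable (lebesgue_on (ball x0 a)) \<and>
        (AE x in lebesgue_on (ball x0 a). \<bar>X x - P x\<bar> \<le> \<bar>C\<bar> * a powr \<alpha>)" by auto
    qed simp
  qed simp
  with P show "\<exists>P \<in> polys_deg_less \<alpha>. decays \<infinity> \<alpha> x0 (\<lambda>x. X x - P x)" by blast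
next
  assume "\<exists>P \<in> polys_deg_less \<alpha>. decays \<infinity> \<alpha> x0 (\<lambda>x. X x - P x)"
  then obtain P where P: "P \<in> polys_deg_less \<alpha>" "decays \<infinity> \<alpha> x0 (\<lambda>x. X x - P x)" by blast
  have near: "(\<lambda>x. X x - P x) \<in> Lp_near \<infinity> x0" by (rule Lp_near_of_decays[OF P(2)]) simp
  obtain C where C: "C \<ge> 1" "\<forall>\<^sub>F a in at_right 0. (\<lambda>x. X x - P x) \<in> borel_measurable (lebesgue_on (ball x0 a)) \<and>
    (AE x in lebesgue_on (ball x0 a). \<bar>X x - P x\<bar> \<le> C * a powr \<alpha>)"
    using P(2) by (rule decaysE_infinity)
  have "\<forall>\<^sub>F a in at_right 0. local_norm \<infinity> x0 a (\<lambda>x. X x - P x) \<le> ereal (C * a powr \<alpha>)"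
    using C(2)
  proof eventually_elim
    case (elim a)
    then have [measurable]: "(\<lambda>x. X x - P x) \<in> borel_measurable (lebesgue_on (ball x0 a))" by simp
    from elim show ?case unfolding local_norm_def by (auto intro!: esssup_I)
  qed
  with P Lp_near_add_poly[OF near P(1)] show "X \<in> T_space \<infinity> \<alpha> x0" unfolding T_space_def by auto
qed

lemma T_space_iff:
  assumes "1 \<le> p"
  shows "X \<in> T_space p \<alpha> x0 \<longleftrightarrow> (\<exists>P \<in> polys_deg_less \<alpha>. decays p \<alpha> x0 (\<lambda>x. X x - P x))"
  using assms by (cases p rule: ereal_exponent_cases) (simp_all add: T_space_iff_real T_space_iff_infinity)

section \<open>Monotonicity and concavity of the exponent\<close>

lemma T_space_antimono:
  assumes "X \<in> T_space q \<alpha> x0" "1 \<le> p" "p \<le> q"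
  shows "X \<in> T_space p \<alpha> x0"
proof -
  have "1 \<le> q" using assms by simp
  with assms show ?thesis by (auto simp: T_space_iff intro: decays_antimono_exponent)
qed

lemma Lp_near_antimono:
  assumes "X \<in> Lp_near q x0" "1 \<le> p" "p \<le> q"
  shows "X \<in> Lp_near p x0"
proof -
  have q: "1 \<le> q" using assms by simp
  then have "\<exists>\<beta>. decays q \<beta> x0 X"
    by (cases q rule: ereal_exponent_cases)
       (use assms(1) decays_of_Lp_near_real decays_of_Lp_near_infinity in blast)+
  then show ?thesis using assms by (blast intro: Lp_near_of_decays decays_antimono_exponent)
qed

lemma neg_div_ereal_mono:
  assumes "1 \<le> (p::ereal)" "p \<le> q" "0 \<le> (d::real)"
  shows "- (ereal d / p) \<le> - (ereal d / q)"
  using assms by (cases p; cases q) (auto simp: frac_le)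

lemma p_exponent_upper:
  fixes x0 :: "real ^ 'd"
  assumes "X \<in> T_space p \<alpha> x0" "- (ereal (real CARD('d)) / p) \<le> ereal \<alpha>"
  shows "ereal \<alpha> \<le> p_exponent p x0 X"
  unfolding p_exponent_def using assms by (intro Sup_upper) auto

lemma p_exponent_lower_bound:
  fixes x0 :: "real ^ 'd"
  assumes "X \<in> Lp_near p x0" "1 \<le> p"
  shows "- (ereal (real CARD('d)) / p) \<le> p_exponent p x0 X"
  using \<open>1 \<le> p\<close>
proof (cases p rule: ereal_exponent_cases)
  case (real r)
  have "X \<in> T_space (ereal r) (- (real CARD('d) / r)) x0"
    using decays_of_Lp_near_real[of X r x0] assms(1) real zero_in_polys
    by (auto simp: T_space_iff intro!: bexI[of _ "\<lambda>x. 0"])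
  then show ?thesis using p_exponent_upper[of X p "- (real CARD('d) / r)" x0] real by auto
next
  case infinity
  have "X \<in> T_space \<infinity> 0 x0"
    using decays_of_Lp_near_infinity[of X x0] assms(1) infinity zero_in_polys
    by (auto simp: T_space_iff intro!: bexI[of _ "\<lambda>x. 0"])
  then show ?thesis using p_exponent_upper[of X p 0 x0] infinity by (auto simp: zero_ereal_def)
qed

lemma p_exponent_antimono:
  fixes x0 :: "real ^ 'd"
  assumes "1 \<le> p" "p \<le> q"
  shows "p_exponent q x0 X \<le> p_exponent p x0 X"
  unfolding p_exponent_def
proof (rule Sup_subset_mono, clarify)
  fix \<alpha> assume \<alpha>: "- (ereal (real CARD('d)) / q) \<le> ereal \<alpha>" "X \<in> T_space q \<alpha> x0"
  have "- (ereal (real CARD('d)) / p) \<le> ereal \<alpha>"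
    using neg_div_ereal_mono[OF assms, of "real CARD('d)"] \<alpha>(1) by (rule order_trans) simp
  moreover have "X \<in> T_space p \<alpha> x0" using \<alpha>(2) assms by (rule T_space_antimono)
  ultimately show "\<exists>\<alpha>'. ereal \<alpha> = ereal \<alpha>' \<and> - (ereal (real CARD('d)) / p) \<le> ereal \<alpha>' \<and> X \<in> T_space p \<alpha>' x0"
    by blast
qed

text \<open>When \<open>\<beta> < \<alpha>\<close>, the approximating polynomials \<open>P\<close> and \<open>Q\<close> attached to \<open>p < q\<close> may differ. Their
  difference decays like \<open>a powr \<beta>\<close> in \<open>L\<^sup>p\<close> mean, hence uniformly, so that \<open>P\<close> also serves for \<open>q\<close>;
  interpolation then applies to \<open>X - P\<close>, and the part of \<open>P\<close> of degree at least
  \<open>u * \<alpha> + v * \<beta>\<close> is negligible at that rate.\<close>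

lemma T_space_interpolate:
  fixes x0 :: "real ^ 'd"
  assumes xy: "0 \<le> y" "y < x" "x \<le> 1" and uv: "0 < u" "0 < v" "u + v = 1"
    and X: "X \<in> T_space (1 / ereal x) \<alpha> x0" "X \<in> T_space (1 / ereal y) \<beta> x0" and \<beta>\<alpha>: "\<beta> < \<alpha>"
  shows "X \<in> T_space (1 / ereal (u * x + v * y)) (u * \<alpha> + v * \<beta>) x0"
proof -
  define p q s \<gamma> where "p = 1 / ereal x" and "q = 1 / ereal y" and "s = 1 / (u * x + v * y)"
    and "\<gamma> = u * \<alpha> + v * \<beta>"
  define z where "z = u * x + v * y"
  have z: "0 < z" "z \<le> x"
  proof -
    have "v * y \<le> v * x" using xy uv by (intro mult_left_mono) auto
    then show "z \<le> x" using uv(3) unfolding z_def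
      by (metis add_left_mono distrib_right mult_1)
    show "0 < z" unfolding z_def using xy uv by (intro add_pos_nonneg mult_pos_pos) auto
  qed
  have p: "p = ereal (1 / x)" "1 \<le> p" using xy by (auto simp: p_def divide_ereal_def field_simps one_ereal_def)
  have s: "1 / ereal (u * x + v * y) = ereal s" "s = 1 / z" "1 \<le> ereal s"
    using z xy by (auto simp: s_def z_def divide_ereal_def field_simps one_ereal_def)
  have q: "1 \<le> q" "p \<le> q"
    using xy by (auto simp: p_def q_def divide_ereal_def one_ereal_def inverse_eq_divide frac_le field_simps)
  obtain P where P: "P \<in> polys_deg_less \<alpha>" "decays p \<alpha> x0 (\<lambda>x. X x - P x)"
    using X(1) p(2) unfolding p_def[symmetric] T_space_iff[OF p(2)] by blast
  obtain Q where Q: "Q \<in> polys_deg_less \<beta>" "decays q \<beta> x0 (\<lambda>x. X x - Q x)"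
    using X(2) q(1) unfolding q_def[symmetric] T_space_iff[OF q(1)] by blast
  have PQ: "(\<lambda>x. P x - Q x) \<in> polys_deg_less \<alpha>"
    using P Q \<beta>\<alpha> by (intro polys_diff) (auto intro: polys_mono)
  have "decays p \<beta> x0 (\<lambda>x. (X x - Q x) - (X x - P x))"
    using decays_antimono_exponent[OF Q(2) p(2) q(2)] decays_cmono[OF P(2) less_imp_le[OF \<beta>\<alpha>] p(2)] p(2)
    by (rule decays_diff)
  then have "decays (ereal (1 / x)) \<beta> x0 (\<lambda>x. P x - Q x)" by (simp add: p(1))
  then obtain C where C: "C \<ge> 0" "\<forall>\<^sub>F a in at_right 0.
      (\<lambda>x. P x - Q x) \<in> borel_measurable (lebesgue_on (ball x0 a)) \<and>
      energy (1 / x) (ball x0 a) (\<lambda>x. P x - Q x) \<le> ennreal (C * a powr (real CARD('d) + \<beta> * (1 / x)))"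
    by (rule decaysE_real)
  define i :: 'd where "i = undefined"
  have half: "{x. x0 $ i < x $ i} \<in> sets lebesgue"
    by (auto intro!: borel_open open_Collect_less continuous_intros)
  have small: "\<forall>\<^sub>F a in at_right 0. energy (1 / x) (ball x0 a \<inter> {x. x0 $ i < x $ i}) (\<lambda>x. P x - Q x)
      \<le> ennreal (C * a powr (real CARD('d) + \<beta> * (1 / x)))"
    using C(2)
  proof eventually_elim
    case (elim a)
    have "energy (1 / x) (ball x0 a \<inter> {x. x0 $ i < x $ i}) (\<lambda>x. P x - Q x)
        \<le> energy (1 / x) (ball x0 a) (\<lambda>x. P x - Q x)"
      using half by (intro energy_mono) auto
    with elim show ?case by (auto intro: order_trans)
  qed
  have "\<exists>c. \<forall>x. P x - Q x = (\<Sum>k | real (mdeg k) < \<alpha> \<and> \<beta> \<le> real (mdeg k). c k * monomial k (x - x0))"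
    by (rule polys_low_degree_part_vanishes[OF PQ _ small]) (use z in auto)
  then obtain c where c: "\<And>x. P x - Q x = (\<Sum>k | real (mdeg k) < \<alpha> \<and> \<beta> \<le> real (mdeg k). c k * monomial k (x - x0))"
    by blast
  have fin: "finite {k :: 'd \<Rightarrow> nat. real (mdeg k) < \<alpha> \<and> \<beta> \<le> real (mdeg k)}"
    by (rule finite_subset[OF _ finite_mdeg[of \<alpha>]]) auto
  obtain M where M: "M \<ge> 0" "\<And>a u. 0 < a \<Longrightarrow> a \<le> 1 \<Longrightarrow> norm u \<le> a \<Longrightarrow>
      \<bar>\<Sum>k | real (mdeg k) < \<alpha> \<and> \<beta> \<le> real (mdeg k). c k * monomial k u\<bar> \<le> M * a powr \<beta>"
    using monomials_high_degree_small[OF fin, of \<beta> c] by blast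
  have "decays q \<beta> x0 (\<lambda>x. P x - Q x)"
    using q(1) by (intro decays_of_bounded[OF continuous_polys[OF PQ] M(1)])
      (auto simp: c dist_norm norm_minus_commute intro: M(2))
  from decays_diff[OF Q(2) this q(1)] have Pq: "decays q \<beta> x0 (\<lambda>x. X x - P x)" by simp
  have "decays (ereal s) \<gamma> x0 (\<lambda>x. X x - P x)"
  proof (cases "y = 0")
    case True
    then have q': "q = \<infinity>" by (simp add: q_def)
    have zx: "z = u * x" using True by (simp add: z_def)
    have v: "v = 1 - u" using uv by simp
    show ?thesis
    proof (rule decays_interpolate_infinity)
      show "decays (ereal (1 / x)) \<alpha> x0 (\<lambda>x. X x - P x)" using P(2) p(1) by simp
      show "decays \<infinity> \<beta> x0 (\<lambda>x. X x - P x)" using Pq q' by simp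
      show "1 / x \<le> s" unfolding s(2) using z by (intro frac_le) auto
      show "\<gamma> * s = \<alpha> * (1 / x) + \<beta> * (s - 1 / x)"
        unfolding s(2) \<gamma>_def zx v using uv(1) xy z by (simp add: field_simps)
    qed
  next
    case False
    then have q': "q = ereal (1 / y)" by (simp add: q_def divide_ereal_def one_ereal_def inverse_eq_divide)
    have w1: "1 - v * y / z = u * x / z" using z(1) by (simp add: z_def field_simps)
    show ?thesis
    proof (rule decays_interpolate_real[where w = "v * y / z"])
      show "decays (ereal (1 / x)) \<alpha> x0 (\<lambda>x. X x - P x)" using P(2) p(1) by simp
      show "decays (ereal (1 / y)) \<beta> x0 (\<lambda>x. X x - P x)" using Pq q' by simp
      show "1 / x < 1 / y" using xy False by (intro divide_strict_left_mono) auto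
      show "0 \<le> v * y / z" using uv xy z by auto
      show "v * y / z \<le> 1" using uv xy z by (simp add: z_def)
      show "s = (1 - v * y / z) * (1 / x) + v * y / z * (1 / y)"
        unfolding w1 s(2) using z False xy uv(3) by (simp flip: add_divide_distrib)
      show "\<gamma> * s = (1 - v * y / z) * (\<alpha> * (1 / x)) + v * y / z * (\<beta> * (1 / y))"
        unfolding w1 s(2) \<gamma>_def using z False xy by (simp add: add_divide_distrib)
    qed
  qed
  moreover obtain R N where R: "R \<in> polys_deg_less \<gamma>" "N \<ge> 0"
    "\<And>a x. 0 < a \<Longrightarrow> a \<le> 1 \<Longrightarrow> x \<in> ball x0 a \<Longrightarrow> \<bar>P x - R x\<bar> \<le> N * a powr \<gamma>"
    using polys_truncate[OF P(1)] by metis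
  have "decays (ereal s) \<gamma> x0 (\<lambda>x. P x - R x)"
    using continuous_polys[OF P(1)] continuous_polys[OF R(1)] R(2,3) s(3)
    by (intro decays_of_bounded[of _ N] continuous_intros) auto
  ultimately have "decays (ereal s) \<gamma> x0 (\<lambda>x. (X x - P x) + (P x - R x))"
    using s(3) by (rule decays_add)
  with R(1) show ?thesis unfolding s(1) T_space_iff[OF s(3)] \<gamma>_def[symmetric] by auto
qed

lemma ereal_Sup_convex_combination_le:
  fixes c :: ereal and u v :: real
  assumes "A \<noteq> {}" "B \<noteq> {}" "0 < u" "0 < v"
    and le: "\<And>\<alpha> \<beta>. \<alpha> \<in> A \<Longrightarrow> \<beta> \<in> B \<Longrightarrow> ereal (u * \<alpha> + v * \<beta>) \<le> c"
  shows "ereal u * Sup (ereal ` A) + ereal v * Sup (ereal ` B) \<le> c"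
proof (cases c)
  case (real c')
  obtain \<alpha>0 \<beta>0 where ab0: "\<alpha>0 \<in> A" "\<beta>0 \<in> B" using assms by blast
  have le': "u * \<alpha> + v * \<beta> \<le> c'" if "\<alpha> \<in> A" "\<beta> \<in> B" for \<alpha> \<beta>
    using le[OF that] real by simp
  have "Sup (ereal ` A) \<le> ereal ((c' - v * \<beta>0) / u)"
    using le'[OF _ ab0(2)] assms(3) by (intro Sup_least) (auto simp: field_simps)
  moreover have "ereal \<alpha>0 \<le> Sup (ereal ` A)" using ab0 by (intro Sup_upper) auto
  ultimately obtain a where a: "Sup (ereal ` A) = ereal a" by (cases "Sup (ereal ` A)") auto
  have "u * a + v * \<beta> \<le> c'" if "\<beta> \<in> B" for \<beta>
  proof -
    have "Sup (ereal ` A) \<le> ereal ((c' - v * \<beta>) / u)"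
      using le'[OF _ that] assms(3) by (intro Sup_least) (auto simp: field_simps)
    then show ?thesis using a assms(3) by (simp add: field_simps)
  qed
  then have "Sup (ereal ` B) \<le> ereal ((c' - u * a) / v)"
    using assms(4) by (intro Sup_least) (auto simp: field_simps)
  moreover have "ereal \<beta>0 \<le> Sup (ereal ` B)" using ab0 by (intro Sup_upper) auto
  ultimately obtain b where b: "Sup (ereal ` B) = ereal b" "b \<le> (c' - u * a) / v"
    by (cases "Sup (ereal ` B)") auto
  then show ?thesis using a real assms(4) by (simp add: field_simps)
next
  case MInf
  with le assms(1,2) show ?thesis by force
qed auto

lemma one_div_ereal_ge_1: "0 \<le> x \<Longrightarrow> x \<le> 1 \<Longrightarrow> 1 \<le> 1 / ereal x"
  by (cases "x = 0") (auto simp: divide_ereal_def one_ereal_def field_simps)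

lemma one_div_ereal_mono: "0 \<le> x \<Longrightarrow> x \<le> y \<Longrightarrow> 1 / ereal y \<le> 1 / ereal x"
  by (cases "x = 0") (auto simp: divide_ereal_def one_ereal_def field_simps)

lemma neg_div_one_div: "0 \<le> x \<Longrightarrow> - (ereal d / (1 / ereal x)) = ereal (- (d * x))"
  by (cases "x = 0") (auto simp: divide_ereal_def one_ereal_def zero_ereal_def)

text \<open>For admissible \<open>\<alpha>\<close> at \<open>x\<close> and \<open>\<beta>\<close> at \<open>y\<close> with \<open>\<alpha> \<le> \<beta>\<close> no interpolation is needed: \<open>\<beta>\<close> is admissible for the
  smaller exponent \<open>1 / (u * x + v * y)\<close> too, and \<open>u * \<alpha> + v * \<beta> \<le> \<beta>\<close>.\<close>

lemma p_exponent_concave_ordered: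
  fixes x0 :: "real ^ 'd"
  assumes xy: "0 \<le> y" "y < x" "x \<le> 1" and uv: "0 < u" "0 < v" "u + v = 1"
    and X: "X \<in> Lp_near (1 / ereal x) x0" "X \<in> Lp_near (1 / ereal y) x0"
  shows "ereal u * p_exponent (1 / ereal x) x0 X + ereal v * p_exponent (1 / ereal y) x0 X
    \<le> p_exponent (1 / ereal (u * x + v * y)) x0 X"
proof -
  define A where "A r = {\<alpha>. - (ereal (real CARD('d)) / (1 / ereal r)) \<le> ereal \<alpha> \<and> X \<in> T_space (1 / ereal r) \<alpha> x0}" for r
  have h: "p_exponent (1 / ereal r) x0 X = Sup (ereal ` A r)" for r
    unfolding p_exponent_def A_def by (rule arg_cong[of _ _ Sup]) auto
  have ne: "A r \<noteq> {}" if "0 \<le> r" "r \<le> 1" "X \<in> Lp_near (1 / ereal r) x0" for r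
  proof
    assume "A r = {}"
    then have "p_exponent (1 / ereal r) x0 X = -\<infinity>" unfolding h by (simp add: bot_ereal_def)
    with p_exponent_lower_bound[OF that(3) one_div_ereal_ge_1[OF that(1,2)]] that(1)
    show False by (simp add: neg_div_one_div del: uminus_ereal.simps)
  qed
  define z where "z = u * x + v * y"
  have z: "y \<le> z" "z \<le> x"
  proof -
    have "v * y \<le> v * x" "u * y \<le> u * x" using xy uv by (auto intro!: mult_left_mono)
    moreover have "u * x + v * x = x" "u * y + v * y = y" using uv(3) by (metis distrib_right mult_1)+
    ultimately show "y \<le> z" "z \<le> x" unfolding z_def by linarith+
  qed
  have z1: "1 \<le> 1 / ereal z" using z xy by (intro one_div_ereal_ge_1) auto
  have "ereal (u * \<alpha> + v * \<beta>) \<le> p_exponent (1 / ereal z) x0 X" if "\<alpha> \<in> A x" "\<beta> \<in> A y" for \<alpha> \<beta>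
  proof (cases "\<beta> < \<alpha>")
    case True
    have T: "X \<in> T_space (1 / ereal z) (u * \<alpha> + v * \<beta>) x0"
      unfolding z_def using that True by (intro T_space_interpolate xy uv) (auto simp: A_def)
    have "- (real CARD('d) * x) \<le> \<alpha>" "- (real CARD('d) * y) \<le> \<beta>"
      using that xy by (auto simp: A_def neg_div_one_div)
    then have "u * (- (real CARD('d) * x)) + v * (- (real CARD('d) * y)) \<le> u * \<alpha> + v * \<beta>"
      using uv by (intro add_mono mult_left_mono) auto
    then have "- (real CARD('d) * z) \<le> u * \<alpha> + v * \<beta>" by (simp add: z_def algebra_simps)
    with T z xy show ?thesis by (intro p_exponent_upper) (auto simp: neg_div_one_div)
  next
    case False
    have "X \<in> T_space (1 / ereal y) \<beta> x0" using that by (simp add: A_def)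
    then have "X \<in> T_space (1 / ereal z) \<beta> x0"
      using z1 one_div_ereal_mono[OF xy(1) z(1)] by (rule T_space_antimono)
    moreover have "- (real CARD('d) * z) \<le> \<beta>"
    proof -
      have "real CARD('d) * y \<le> real CARD('d) * z" using z by (intro mult_left_mono) auto
      moreover have "- (real CARD('d) * y) \<le> \<beta>" using that xy by (auto simp: A_def neg_div_one_div)
      ultimately show ?thesis by linarith
    qed
    ultimately have "ereal \<beta> \<le> p_exponent (1 / ereal z) x0 X"
      using z xy by (intro p_exponent_upper) (auto simp: neg_div_one_div)
    moreover have "u * \<alpha> + v * \<beta> \<le> \<beta>"
    proof -
      have "u * \<alpha> \<le> u * \<beta>" using False uv by (intro mult_left_mono) auto
      moreover have "u * \<beta> + v * \<beta> = \<beta>" using uv(3) by (metis distrib_right mult_1)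
      ultimately show ?thesis by linarith
    qed
    ultimately show ?thesis by (meson ereal_less_eq(3) order_trans)
  qed
  then show ?thesis
    unfolding h[of x] h[of y] z_def[symmetric] using X xy uv
    by (intro ereal_Sup_convex_combination_le ne) auto
qed

lemma p_exponent_concave:
  fixes x0 :: "real ^ 'd" and X
  defines "D \<equiv> exponent_domain x0 X"
  shows "concave_on_ereal {r \<in> {0..1}. 1 / ereal r \<in> D} (\<lambda>r. p_exponent (1 / ereal r) x0 X)"
proof -
  let ?S = "{r \<in> {0..1}. 1 / ereal r \<in> D}"
  let ?h = "\<lambda>r. p_exponent (1 / ereal r) x0 X"
  have S: "r \<in> ?S \<longleftrightarrow> 0 \<le> r \<and> r \<le> 1 \<and> X \<in> Lp_near (1 / ereal r) x0" for r
    by (auto simp: D_def exponent_domain_def one_div_ereal_ge_1)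
  have up: "r' \<in> ?S" if "r \<in> ?S" "r \<le> r'" "r' \<le> 1" for r r'
    using that Lp_near_antimono[OF _ one_div_ereal_ge_1 one_div_ereal_mono, of X r x0 r'] unfolding S by auto
  have "is_interval ?S"
    unfolding is_interval_1
  proof (intro ballI allI impI)
    fix a b x assume "a \<in> ?S" "b \<in> ?S" "a \<le> x \<and> x \<le> b"
    then show "x \<in> ?S" using up[of a x] by auto
  qed
  then have conv: "convex ?S" by (simp add: is_interval_convex_1)
  have gt: "?h r \<noteq> -\<infinity>" if "r \<in> ?S" for r
  proof -
    have r: "0 \<le> r" "r \<le> 1" "X \<in> Lp_near (1 / ereal r) x0" using that unfolding S by auto
    from p_exponent_lower_bound[OF r(3) one_div_ereal_ge_1[OF r(1,2)]] r(1)
    show ?thesis by (auto simp: neg_div_one_div)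
  qed
  have "ereal u * ?h x + ereal v * ?h y \<le> ?h (u * x + v * y)"
    if "x \<in> ?S" "y \<in> ?S" "0 \<le> u" "0 \<le> v" "u + v = 1" for x y u v
  proof -
    have xy: "0 \<le> x" "x \<le> 1" "X \<in> Lp_near (1 / ereal x) x0" "0 \<le> y" "y \<le> 1" "X \<in> Lp_near (1 / ereal y) x0"
      using that(1,2) unfolding S by auto
    consider "u = 0" | "v = 0" | "0 < u" "0 < v" "x = y" | "0 < u" "0 < v" "y < x" | "0 < u" "0 < v" "x < y"
      using \<open>0 \<le> u\<close> \<open>0 \<le> v\<close> by (metis order_le_less linorder_cases)
    then show ?thesis
    proof cases
      case 3
      have "u * y + v * y = y" using that(5) by (metis distrib_right mult_1)
      moreover have "ereal u * t + ereal v * t = t" if "t \<noteq> -\<infinity>" for t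
        using that 3 \<open>u + v = 1\<close> by (cases t) (auto simp flip: distrib_right)
      ultimately show ?thesis using 3 gt[OF that(2)] by auto
    next
      case 4
      with xy that show ?thesis by (intro p_exponent_concave_ordered) auto
    next
      case 5
      with xy that show ?thesis
        using p_exponent_concave_ordered[of x y v u X x0] by (simp add: add.commute)
    qed (use that in \<open>auto simp flip: zero_ereal_def one_ereal_def\<close>)
  qed
  with conv gt show ?thesis unfolding concave_on_ereal_def by blast
qed

lemma L1_loc_subset_Lp_near_1: "X \<in> L1_loc \<Longrightarrow> X \<in> Lp_near 1 x0"
proof -
  assume "X \<in> L1_loc"
  then have "X absolutely_integrable_on cball x0 1" by (auto simp: L1_loc_def)
  then have "X absolutely_integrable_on ball x0 1" by (rule set_integrable_subset) auto
  then have "X \<in> borel_measurable (lebesgue_on (ball x0 1))" "integrable (lebesgue_on (ball x0 1)) (\<lambda>x. \<bar>X x\<bar>)"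
    by (simp_all add: absolutely_integrable_measurable o_def)
  then show ?thesis unfolding Lp_near_def Lp_def
    by (auto intro!: exI[of _ "ball x0 1"])
qed

lemma exponent_domain_eq:
  fixes x0 :: "real ^ 'd" and X
  assumes "X \<in> L1_loc"
  defines "p0 \<equiv> critical_exponent x0 X"
  shows "exponent_domain x0 X = {1..<p0} \<union> (if X \<in> Lp_near p0 x0 then {p0} else {})" "1 \<le> p0"
proof -
  have p0: "p0 = Sup (exponent_domain x0 X)"
    unfolding p0_def critical_exponent_def exponent_domain_def ..
  have "1 \<in> exponent_domain x0 X"
    using L1_loc_subset_Lp_near_1[OF assms(1)] by (simp add: exponent_domain_def)
  then show p01: "1 \<le> p0" unfolding p0 by (rule Sup_upper)
  show "exponent_domain x0 X = {1..<p0} \<union> (if X \<in> Lp_near p0 x0 then {p0} else {})"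
  proof (intro equalityI subsetI)
    fix p assume p: "p \<in> exponent_domain x0 X"
    then have "p \<le> p0" unfolding p0 by (rule Sup_upper)
    with p show "p \<in> {1..<p0} \<union> (if X \<in> Lp_near p0 x0 then {p0} else {})"
      by (cases "p = p0") (auto simp: exponent_domain_def)
  next
    fix p assume p: "p \<in> {1..<p0} \<union> (if X \<in> Lp_near p0 x0 then {p0} else {})"
    show "p \<in> exponent_domain x0 X"
    proof (cases "p < p0")
      case True
      then obtain q where "q \<in> exponent_domain x0 X" "p < q" unfolding p0 less_Sup_iff by blast
      with p p01 show ?thesis
        by (auto simp: exponent_domain_def split: if_splits intro: Lp_near_antimono)
    next
      case False
      with p p01 show ?thesis by (auto simp: exponent_domain_def split: if_splits)
    qed
  qed
qed

text \<open>By monotonicity \<open>- d / q\<close> is a lower bound of the exponent at \<open>p\<close> for every \<open>q\<close> in the domain, not only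
  for \<open>q = p\<close>; the claim is the limit of this bound for \<open>q\<close> tending to the critical exponent.\<close>

lemma p_exponent_ge_critical:
  fixes x0 :: "real ^ 'd"
  assumes p: "p \<in> exponent_domain x0 X"
  shows "- (ereal (real CARD('d)) / critical_exponent x0 X) \<le> p_exponent p x0 X"
proof (rule ccontr)
  let ?d = "real CARD('d)"
  assume neg: "\<not> ?thesis"
  have crit: "critical_exponent x0 X = Sup (exponent_domain x0 X)"
    unfolding critical_exponent_def exponent_domain_def ..
  have p': "1 \<le> p" "X \<in> Lp_near p x0" using p by (auto simp: exponent_domain_def)
  have ge: "- (ereal ?d / q) \<le> p_exponent p x0 X" if q: "q \<in> exponent_domain x0 X" for q
  proof (cases "p \<le> q")
    case True
    have "- (ereal ?d / q) \<le> p_exponent q x0 X"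
      using q by (intro p_exponent_lower_bound) (auto simp: exponent_domain_def)
    also have "\<dots> \<le> p_exponent p x0 X" by (rule p_exponent_antimono[OF p'(1) True])
    finally show ?thesis .
  next
    case False
    have "- (ereal ?d / q) \<le> - (ereal ?d / p)"
      using q False by (intro neg_div_ereal_mono) (auto simp: exponent_domain_def)
    also have "\<dots> \<le> p_exponent p x0 X" by (rule p_exponent_lower_bound[OF p'(2,1)])
    finally show ?thesis .
  qed
  have p0: "1 \<le> critical_exponent x0 X"
    unfolding crit using p p' by (auto intro: order_trans Sup_upper)
  obtain c where c: "p_exponent p x0 X = ereal c"
    using ge[OF p] neg p'(1) by (cases "p_exponent p x0 X"; cases p) auto
  have cneg: "c < 0" and d: "ereal (?d / - c) < critical_exponent x0 X"
  proof -
    have "ereal c < - (ereal ?d / critical_exponent x0 X)" using neg c by simp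
    from p0 have "c < 0 \<and> ereal (?d / - c) < critical_exponent x0 X"
    proof (cases "critical_exponent x0 X" rule: ereal_exponent_cases)
      case 1: (real k)
      then have "c < - (?d / k)" using \<open>ereal c < _\<close> by simp
      moreover have "0 < ?d / k" using 1 by simp
      ultimately have "c < 0" by linarith
      moreover have "?d < - c * k" using \<open>c < - (?d / k)\<close> 1 by (simp add: field_simps)
      ultimately show ?thesis using 1 by (simp add: pos_divide_less_eq mult.commute del: divide_minus_right)
    next
      case 2: infinity
      then have "ereal c < 0" using \<open>ereal c < _\<close> by simp
      with 2 show ?thesis by simp
    qed
    then show "c < 0" "ereal (?d / - c) < critical_exponent x0 X" by blast+
  qed
  from d obtain q where q: "q \<in> exponent_domain x0 X" "ereal (?d / - c) < q"
    unfolding crit less_Sup_iff by blast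
  have "1 \<le> q" using q(1) by (simp add: exponent_domain_def)
  then have "ereal c < - (ereal ?d / q)"
  proof (cases q rule: ereal_exponent_cases)
    case (real t)
    have "?d < t * - c"
      using q(2) cneg real(1) by (simp add: pos_divide_less_eq del: divide_minus_right)
    then have "c < - (?d / t)" using real(2) by (simp add: field_simps)
    with real show ?thesis by simp
  next
    case infinity
    with cneg show ?thesis by simp
  qed
  with ge[OF q(1)] c show False by simp
qed

section \<open>Concave functions as lower limits of chords\<close>

text \<open>The interval \<open>{s..t}\<close> is swept again and again, at the \<open>m\<close>-th time in \<open>2 * m + 1\<close> equal steps:
  the times \<open>m\<^sup>2 \<le> n < (m + 1)\<^sup>2\<close> belong to the \<open>m\<close>-th sweep.\<close>

lemma typewriter_sequence:
  fixes s t :: real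
  assumes "s < t"
  shows "\<exists>x y :: nat \<Rightarrow> real.
    (\<forall>n. s \<le> x n \<and> x n < y n \<and> y n \<le> t) \<and> (\<lambda>n. y n - x n) \<longlonglongrightarrow> 0 \<and>
    (\<forall>r. s \<le> r \<and> r \<le> t \<longrightarrow> (\<exists>\<^sub>F n in sequentially. x n \<le> r \<and> r \<le> y n))"
proof -
  define L where "L = t - s"
  have L: "L > 0" using assms by (simp add: L_def)
  define m where "m n = floor_sqrt n" for n
  define k where "k n = n - (m n)\<^sup>2" for n
  define N where "N n = real (2 * m n + 1)" for n
  have N: "N n > 0" for n by (simp add: N_def)
  have k: "real (k n) + 1 \<le> N n" for n
  proof -
    have "n < (Suc (m n))\<^sup>2" unfolding m_def by (rule Suc_floor_sqrt_power2_gt)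
    then have "k n \<le> 2 * m n" unfolding k_def by (simp add: power2_eq_square)
    then show ?thesis by (simp add: N_def)
  qed
  define x where "x n = s + L * (real (k n) / N n)" for n
  define y where "y n = x n + L / N n" for n
  show ?thesis
  proof (rule exI[of _ x], rule exI[of _ y], intro conjI allI impI; (elim conjE)?)
    show "s \<le> x n" for n using L N[of n] by (simp add: x_def)
    show "x n < y n" for n using L N[of n] by (simp add: y_def)
    show "y n \<le> t" for n
    proof -
      have "y n = s + L * ((real (k n) + 1) / N n)"
        by (simp add: x_def y_def add_divide_distrib distrib_left)
      also have "\<dots> \<le> s + L * 1" using k[of n] N[of n] L by (intro add_left_mono mult_left_mono) auto
      finally show ?thesis by (simp add: L_def)
    qed
    have "filterlim m at_top sequentially"
      unfolding filterlim_at_top m_def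
    proof
      fix Z show "\<forall>\<^sub>F n in sequentially. Z \<le> floor_sqrt n"
        using eventually_ge_at_top[of "Z\<^sup>2"] by eventually_elim (simp add: le_floor_sqrt_iff)
    qed
    then have "filterlim (\<lambda>n. real (m n)) at_top sequentially"
      by (rule filterlim_compose[OF filterlim_real_sequentially])
    then have "((\<lambda>n. L / (2 * real (m n) + 1)) \<longlongrightarrow> 0) sequentially"
      by (rule filterlim_compose[rotated]) real_asymp
    then show "(\<lambda>n. y n - x n) \<longlonglongrightarrow> 0" by (simp add: y_def N_def add.commute)
    fix r assume r: "s \<le> r" "r \<le> t"
    show "\<exists>\<^sub>F n in sequentially. x n \<le> r \<and> r \<le> y n"
      unfolding frequently_sequentially
    proof
      fix M :: nat
      define K where "K = 2 * M + 1"
      define q where "q = (r - s) / L"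
      have q: "0 \<le> q" "q \<le> 1" "r = s + L * q" using r L by (auto simp: q_def L_def)
      define j where "j = min (nat \<lfloor>q * real K\<rfloor>) (2 * M)"
      have j: "j \<le> 2 * M" "real j \<le> q * real K" "q * real K \<le> real j + 1"
      proof -
        have "q * real K \<ge> 0" using q by simp
        then have *: "real (nat \<lfloor>q * real K\<rfloor>) \<le> q * real K" "q * real K \<le> real (nat \<lfloor>q * real K\<rfloor>) + 1"
          by linarith+
        show "real j \<le> q * real K" using *(1) by (simp add: j_def)
        have "q * real K \<le> 1 * real K" using q by (intro mult_right_mono) auto
        moreover have "1 * real K = real (2 * M) + 1" by (simp add: K_def)
        ultimately show "q * real K \<le> real j + 1" using *(2) unfolding j_def of_nat_min by linarith
      qed (simp add: j_def)
      define n where "n = M\<^sup>2 + j"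
      have mn: "m n = M" unfolding m_def
        by (rule floor_sqrt_unique) (use j(1) in \<open>auto simp: n_def power2_eq_square\<close>)
      have kn: "k n = j" unfolding k_def mn by (simp add: n_def)
      have Nn: "N n = real K" unfolding N_def mn by (simp add: K_def)
      have K0: "real K > 0" by (simp add: K_def)
      have "real j / real K \<le> q" "q \<le> real j / real K + 1 / real K"
        using j K0 by (simp_all add: field_simps)
      then have "L * (real j / real K) \<le> L * q" "L * q \<le> L * (real j / real K + 1 / real K)"
        using L by (simp_all only: mult_le_cancel_left_pos)
      then have "x n \<le> r \<and> r \<le> y n"
        unfolding q(3) x_def y_def kn Nn by (simp add: distrib_left)
      moreover have "M \<le> n" unfolding n_def by (simp add: power2_nat_le_imp_le trans_le_add1 self_le_power power2_eq_square)
      ultimately show "\<exists>n\<ge>M. x n \<le> r \<and> r \<le> y n" by blast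
    qed
  qed
qed

text \<open>The line through two points of the graph of a concave function lies below the graph between the
  two points and above it elsewhere.\<close>

lemma chord_bounds:
  fixes F :: "real \<Rightarrow> real"
  assumes conc: "concave_on {s..t} F" and xy: "s \<le> x" "x < y" "y \<le> t" and r: "s \<le> r" "r \<le> t"
  defines "c \<equiv> F x + (F y - F x) / (y - x) * (r - x)"
  shows "x \<le> r \<Longrightarrow> r \<le> y \<Longrightarrow> c \<le> F r" "r < x \<or> y < r \<Longrightarrow> F r \<le> c"
proof -
  have three: "(q - p) * F z \<ge> (q - z) * F p + (z - p) * F q"
    if "s \<le> p" "p \<le> z" "z \<le> q" "q \<le> t" "p < q" for p z q
  proof -
    define w where "w = (z - p) / (q - p)"
    have w: "0 \<le> w" "w \<le> 1" "w * (q - p) = z - p" using that by (auto simp: w_def)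
    have "(1 - w) * F p + w * F q \<le> F ((1 - w) *\<^sub>R p + w *\<^sub>R q)"
      using concave_onD[OF conc w(1,2), of p q] that by auto
    also have "(1 - w) *\<^sub>R p + w *\<^sub>R q = z" using w(3) by (simp add: algebra_simps)
    finally have "(q - p) * ((1 - w) * F p + w * F q) \<le> (q - p) * F z"
      using that by (intro mult_left_mono) auto
    moreover have "(q - p) * ((1 - w) * F p + w * F q) = (q - p - w * (q - p)) * F p + w * (q - p) * F q"
      by (simp add: algebra_simps)
    ultimately show ?thesis unfolding w(3) by simp
  qed
  have c: "(y - x) * c = (y - r) * F x + (r - x) * F y"
    using xy unfolding c_def by (simp add: field_simps)
  show "c \<le> F r" if "x \<le> r" "r \<le> y"
  proof -
    have "(y - x) * c \<le> (y - x) * F r" unfolding c using three[of x r y] that xy by auto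
    then show ?thesis using xy by (simp add: mult_le_cancel_left_pos)
  qed
  show "F r \<le> c" if "r < x \<or> y < r"
  proof -
    have "(y - x) * F r \<le> (y - x) * c" unfolding c
      using that three[of r x y] three[of x y r] xy r by (auto simp: algebra_simps)
    then show ?thesis using xy by (simp add: mult_le_cancel_left_pos)
  qed
qed

text \<open>The \<open>n\<close>-th affine function is the chord of \<open>min f n\<close> over the \<open>n\<close>-th interval of a typewriter sequence. At
  a given \<open>r\<close> it is below \<open>f\<close> whenever the interval contains \<open>r\<close>, which happens infinitely often. It is
  never much below: outside the interval it is above \<open>min f n\<close>, and inside it is, the slope being
  nonnegative, at least the value of \<open>min f n\<close> at the left end, which is close to \<open>r\<close>. At \<open>r = s\<close> the left
  end is \<open>s\<close> itself, which is why \<open>f\<close> may jump at \<open>s\<close>. Tangents would not do, since \<open>f\<close> may also be infinitely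
  steep at \<open>s\<close> or finite only there; truncation makes the chords real.\<close>

lemma concave_is_liminf_of_affine:
  fixes f :: "real \<Rightarrow> ereal" and b :: real
  assumes st: "s < t" and conc: "concave_on_ereal {s..t} f" and mono: "mono_on {s..t} f"
    and b: "b \<le> 0" "\<And>r. r \<in> {s..t} \<Longrightarrow> ereal b \<le> f r"
  shows "\<exists>h g :: nat \<Rightarrow> real. (\<forall>n. 0 \<le> g n \<and> b \<le> h n + g n * s) \<and>
    (\<forall>r\<in>{s..t}. \<forall>\<alpha>. ereal \<alpha> < f r \<longrightarrow> (\<forall>\<^sub>F n in sequentially. \<alpha> \<le> h n + g n * r)) \<and>
    (\<forall>r\<in>{s..t}. \<exists>\<^sub>F n in sequentially. ereal (h n + g n * r) \<le> f r)"
proof -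
  obtain x y :: "nat \<Rightarrow> real" where x: "\<And>n. s \<le> x n" and xy: "\<And>n. x n < y n" and y: "\<And>n. y n \<le> t"
    and lim: "(\<lambda>n. y n - x n) \<longlonglongrightarrow> 0"
    and freq: "\<And>r. s \<le> r \<Longrightarrow> r \<le> t \<Longrightarrow> \<exists>\<^sub>F n in sequentially. x n \<le> r \<and> r \<le> y n"
    using typewriter_sequence[OF st] by blast
  have xI: "x n \<in> {s..t}" and yI: "y n \<in> {s..t}" for n
    using x[of n] xy[of n] y[of n] by auto
  define F where "F n r = real_of_ereal (min (f r) (ereal (real n)))" for n r
  have F: "ereal (F n r) = min (f r) (ereal (real n))" if "r \<in> {s..t}" for n r
    using b(2)[OF that] unfolding F_def by (cases "f r") (auto simp: min_def)
  have Fle: "ereal (F n r) \<le> f r" "F n r \<le> real n" if "r \<in> {s..t}" for n r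
  proof -
    show "ereal (F n r) \<le> f r" unfolding F[OF that] by simp
    have "ereal (F n r) \<le> ereal (real n)" unfolding F[OF that] by simp
    then show "F n r \<le> real n" by simp
  qed
  have Fge: "c \<le> F n r" if "r \<in> {s..t}" "ereal c \<le> f r" "c \<le> real n" for c n r
  proof -
    have "ereal c \<le> ereal (F n r)" unfolding F[OF that(1)] using that by simp
    then show ?thesis by simp
  qed
  have Fmono: "F n p \<le> F n q" if "p \<in> {s..t}" "q \<in> {s..t}" "p \<le> q" for n p q
    using that Fle(1)[OF that(1), of n] monotone_onD[OF mono that] Fle(2)[OF that(1), of n]
    by (intro Fge) auto
  have Fconc: "concave_on {s..t} (F n)" for n
  proof (rule concave_on_linorderI)
    show "convex {s..t}" by simp
  next
    fix w p q :: real assume w: "0 < w" "w < 1" and pq: "p \<in> {s..t}" "q \<in> {s..t}" "p < q"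
    have z: "(1 - w) * p + w * q \<in> {s..t}"
      using convexD[of "{s..t}" p q "1 - w" w] w pq by simp
    have "ereal ((1 - w) * F n p + w * F n q) = ereal (1 - w) * ereal (F n p) + ereal w * ereal (F n q)" by simp
    also have "\<dots> \<le> ereal (1 - w) * f p + ereal w * f q"
      using w pq by (intro add_mono ereal_mult_left_mono Fle) auto
    also have "\<dots> \<le> f ((1 - w) * p + w * q)"
      using conc w pq unfolding concave_on_ereal_def by auto
    finally have "ereal ((1 - w) * F n p + w * F n q) \<le> f ((1 - w) * p + w * q)" .
    moreover have "(1 - w) * F n p + w * F n q \<le> (1 - w) * real n + w * real n"
      using w pq by (intro add_mono mult_left_mono Fle) auto
    ultimately show "F n ((1 - w) *\<^sub>R p + w *\<^sub>R q) \<ge> (1 - w) * F n p + w * F n q"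
      using z by (intro Fge) (auto simp: algebra_simps)
  qed
  define g where "g n = (F n (y n) - F n (x n)) / (y n - x n)" for n
  define h where "h n = F n (x n) - g n * x n" for n
  have chord: "h n + g n * r = F n (x n) + (F n (y n) - F n (x n)) / (y n - x n) * (r - x n)" for n r
    unfolding h_def g_def[symmetric] by (simp add: algebra_simps)
  have inside: "h n + g n * r \<le> F n r" if "x n \<le> r" "r \<le> y n" for n r
    unfolding chord using that x[of n] y[of n] by (intro chord_bounds[OF Fconc x xy y]) auto
  have outside: "F n r \<le> h n + g n * r" if "r \<in> {s..t}" "r < x n \<or> y n < r" for n r
    unfolding chord using that by (intro chord_bounds[OF Fconc x xy y]) auto
  have g0: "0 \<le> g n" for n
    unfolding g_def using Fmono[OF xI yI, of n n] xy[of n] by (simp add: less_imp_le)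
  have left: "F n (x n) \<le> h n + g n * r" if "x n \<le> r" for n r
    using mult_nonneg_nonneg[OF g0, of "r - x n" n] that by (simp add: h_def algebra_simps)
  have sI: "s \<in> {s..t}" using st by simp
  have at_s: "F n s \<le> h n + g n * s" for n
    using left[of n s] outside[of s n] x[of n] sI by (cases "x n = s") auto
  show ?thesis
  proof (rule exI[of _ h], rule exI[of _ g], intro conjI allI impI ballI)
    show "0 \<le> g n" for n by (rule g0)
    show "b \<le> h n + g n * s" for n
      using at_s[of n] Fge[OF sI b(2)[OF sI], of n] b(1) by simp
    show "\<exists>\<^sub>F n in sequentially. ereal (h n + g n * r) \<le> f r" if r: "r \<in> {s..t}" for r
    proof (rule frequently_elim1)
      show "\<exists>\<^sub>F n in sequentially. x n \<le> r \<and> r \<le> y n" using freq[of r] r by simp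
      fix n assume "x n \<le> r \<and> r \<le> y n"
      then have "ereal (h n + g n * r) \<le> ereal (F n r)" using inside[of n r] by simp
      also have "\<dots> \<le> f r" by (rule Fle(1)[OF r])
      finally show "ereal (h n + g n * r) \<le> f r" .
    qed
    fix r \<alpha> assume r: "r \<in> {s..t}" and \<alpha>: "ereal \<alpha> < f r"
    have large: "\<forall>\<^sub>F n in sequentially. \<alpha> \<le> real n"
      using eventually_ge_at_top[of "nat \<lceil>\<alpha>\<rceil>"] by eventually_elim linarith
    show "\<forall>\<^sub>F n in sequentially. \<alpha> \<le> h n + g n * r"
    proof (cases "r = s")
      case True
      show ?thesis using large
      proof eventually_elim
        case (elim n)
        have "\<alpha> \<le> F n r" using Fge[OF r less_imp_le[OF \<alpha>] elim] .
        with at_s[of n] True show ?case by simp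
      qed
    next
      case False
      then have rs: "s < r" using r by simp
      obtain c where c: "\<alpha> < c" "ereal c \<le> f r"
        using ereal_dense2[OF \<alpha>] by (auto intro: less_imp_le)
      \<comment> \<open>By concavity \<open>f\<close> is at least \<open>\<alpha>\<close> at some \<open>r'\<close> to the left of \<open>r\<close>, obtained by moving a small
        fraction \<open>u\<close> of the way from \<open>r\<close> to \<open>s\<close>.\<close>
      define u where "u = (c - \<alpha>) / (2 * (\<bar>c - b\<bar> + (c - \<alpha>)))"
      have u: "0 < u" "u < 1" "u * \<bar>c - b\<bar> \<le> c - \<alpha>"
      proof -
        have pos: "0 < 2 * (\<bar>c - b\<bar> + (c - \<alpha>))" using c by (simp add: add_nonneg_pos)
        show "0 < u" using c pos unfolding u_def by simp
        show "u < 1" using c(1) abs_ge_zero[of "c - b"] unfolding u_def divide_less_eq_1_pos[OF pos] by argo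
        have "u * (2 * (\<bar>c - b\<bar> + (c - \<alpha>))) = c - \<alpha>" unfolding u_def using pos by simp
        moreover have "u * \<bar>c - b\<bar> \<le> u * (2 * (\<bar>c - b\<bar> + (c - \<alpha>)))"
          using \<open>0 < u\<close> c by (intro mult_left_mono) auto
        ultimately show "u * \<bar>c - b\<bar> \<le> c - \<alpha>" by simp
      qed
      define r' where "r' = u * s + (1 - u) * r"
      have r': "r' \<in> {s..t}" "r' < r"
      proof -
        show "r' \<in> {s..t}" using convexD[of "{s..t}" s r u "1 - u"] u r sI by (simp add: r'_def)
        have "u * s < u * r" using u rs by simp
        then show "r' < r" by (simp add: r'_def algebra_simps)
      qed
      have "ereal \<alpha> \<le> ereal (u * b + (1 - u) * c)"
      proof -
        have "u * (c - b) \<le> u * \<bar>c - b\<bar>" using u by (intro mult_left_mono) auto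
        with u(3) have "\<alpha> \<le> c - u * (c - b)" by linarith
        then show ?thesis by (simp add: algebra_simps)
      qed
      also have "\<dots> = ereal u * ereal b + ereal (1 - u) * ereal c" by simp
      also have "\<dots> \<le> ereal u * f s + ereal (1 - u) * f r"
        using u c b(2)[OF sI] by (intro add_mono ereal_mult_left_mono) auto
      also have "\<dots> \<le> f r'"
        using conc u r sI unfolding concave_on_ereal_def r'_def by auto
      finally have fr': "ereal \<alpha> \<le> f r'" .
      have "\<forall>\<^sub>F n in sequentially. y n - x n < r - r'"
        using order_tendstoD(2)[OF lim, of "r - r'"] r'(2) by simp
      then show ?thesis using large
      proof eventually_elim
        case (elim n)
        show ?case
        proof (cases "r < x n \<or> y n < r")
          case True
          have "\<alpha> \<le> F n r" using Fge[OF r less_imp_le[OF \<alpha>]] elim by simp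
          with outside[OF r True] show ?thesis by simp
        next
          case False
          then have "r' \<le> x n" using elim by auto
          then have "f r' \<le> f (x n)" using monotone_onD[OF mono r'(1) xI] by auto
          with fr' have "ereal \<alpha> \<le> f (x n)" by (rule order_trans)
          then have "\<alpha> \<le> F n (x n)" using Fge[OF xI] elim by simp
          with left[of n r] False show ?thesis by simp
        qed
      qed
    qed
  qed
qed

section \<open>Functions made of isolated spikes\<close>

text \<open>The \<open>n\<close>-th spike is a ball centred at distance \<open>offset n\<close> from \<open>x0\<close>, on the side \<open>x $ i < x0 $ i\<close>. Its radius is chosen such
  that its measure is \<open>spike_const * offset n powr (d + g n)\<close>. The factor \<open>1 / 4\<close> makes the spikes disjoint and
  keeps them off the hyperplane, and \<open>(n + 1) powr (-2)\<close> is the summable weight.\<close>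

locale spikes =
  fixes x0 :: "real ^ 'd" and i :: 'd and h g :: "nat \<Rightarrow> real"
  assumes g_nonneg: "0 \<le> g n"
begin

definition offset :: "nat \<Rightarrow> real" where
  "offset n = (1 / 2) ^ n"

definition radius :: "nat \<Rightarrow> real" where
  "radius n = offset n powr (1 + g n / real CARD('d)) / 4"

definition spike :: "nat \<Rightarrow> (real ^ 'd) set" where
  "spike n = ball (x0 - offset n *\<^sub>R axis i 1) (radius n)"

definition height :: "nat \<Rightarrow> real" where
  "height n = offset n powr h n * (real n + 1) powr (-2)"

definition X :: "real ^ 'd \<Rightarrow> real" where
  "X x = (\<Sum>n. height n * indicator (spike n) x)"

definition spike_const :: real where
  "spike_const = unit_ball_vol (real CARD('d)) / 4 ^ CARD('d)"

lemma offset: "0 < offset n" "offset n \<le> 1"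
  by (simp_all add: offset_def power_le_one)

lemma offset_antimono: "m \<le> n \<Longrightarrow> offset n \<le> offset m"
  unfolding offset_def by (intro power_decreasing) auto

lemma radius: "0 < radius n" "radius n \<le> offset n / 4"
proof -
  show "0 < radius n" using offset[of n] by (simp add: radius_def)
  have "offset n powr (1 + g n / real CARD('d)) \<le> offset n powr 1"
    using offset[of n] g_nonneg[of n] by (intro powr_mono') auto
  then show "radius n \<le> offset n / 4" using offset[of n] by (simp add: radius_def)
qed

lemma height_pos: "0 < height n"
  using offset[of n] by (simp add: height_def)

lemma spike_const_pos: "0 < spike_const"
  by (simp add: spike_const_def)

lemma spike_sets [measurable]: "spike n \<in> sets lebesgue"
  by (simp add: spike_def)

lemma spike_bounds:
  assumes "x \<in> spike n"
  shows "x $ i < x0 $ i" "norm (x - x0) < 2 * offset n" "offset n / 2 < norm (x - x0)"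
proof -
  define v where "v = x - (x0 - offset n *\<^sub>R axis i 1)"
  have v: "norm v < offset n / 4"
    using assms radius[of n] by (simp add: spike_def v_def dist_norm norm_minus_commute)
  have x: "x - x0 = v - offset n *\<^sub>R axis i 1" by (simp add: v_def)
  have na: "norm (offset n *\<^sub>R axis i (1::real)) = offset n" using offset[of n] by simp
  have "v $ i \<le> norm v" using component_le_norm_cart[of v i] by simp
  moreover have "x $ i - x0 $ i = v $ i - offset n"
    using arg_cong[OF x, of "\<lambda>u. u $ i"] by (simp add: axis_def)
  ultimately show "x $ i < x0 $ i" using v offset[of n] by simp
  show "norm (x - x0) < 2 * offset n"
    using norm_triangle_ineq4[of v "offset n *\<^sub>R axis i (1::real)"] v offset[of n] unfolding x na by simp
  show "offset n / 2 < norm (x - x0)"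
    using norm_triangle_ineq2[of "offset n *\<^sub>R axis i (1::real)" v] v offset[of n] unfolding x na
    by (simp add: norm_minus_commute)
qed

lemma spike_disjoint:
  assumes "m \<noteq> n" shows "spike m \<inter> spike n = {}"
proof -
  have "spike m \<inter> spike n = {}" if "m < n" for m n
  proof -
    have half: "offset n \<le> offset m / 2"
      using offset_antimono[of "Suc m" n] that by (simp add: offset_def)
    have "(x0 - offset n *\<^sub>R axis i 1) - (x0 - offset m *\<^sub>R axis i (1::real)) = (offset m - offset n) *\<^sub>R axis i 1"
      by (simp add: algebra_simps)
    then have "dist (x0 - offset n *\<^sub>R axis i 1) (x0 - offset m *\<^sub>R axis i (1::real)) = offset m - offset n"
      using half offset[of n] by (simp add: dist_norm)
    moreover have "radius m + radius n \<le> offset m - offset n"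
      using radius[of m] radius[of n] half offset[of m] by linarith
    ultimately show ?thesis unfolding spike_def
      by (subst Int_commute) (intro disjoint_ballI, simp add: add.commute)
  qed
  then show ?thesis using assms by (metis Int_commute linorder_neqE_nat)
qed

lemma X_on_spike: "x \<in> spike n \<Longrightarrow> X x = height n"
proof -
  assume x: "x \<in> spike n"
  have "indicator (spike m) x = (0::real)" if "m \<noteq> n" for m
    using x spike_disjoint[OF that] by (auto simp: indicator_def)
  then have "X x = (\<Sum>m\<in>{n}. height m * indicator (spike m) x)"
    unfolding X_def by (intro suminf_finite) auto
  with x show ?thesis by simp
qed

lemma X_off_spikes: "(\<And>n. x \<notin> spike n) \<Longrightarrow> X x = 0"
  unfolding X_def by simp

lemma X_measurable [measurable]: "X \<in> borel_measurable lebesgue"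
  unfolding X_def[abs_def] by measurable

lemma X_powr: "ennreal (\<bar>X x\<bar> powr p) = (\<Sum>n. ennreal (height n powr p) * indicator (spike n) x)"
proof (cases "\<exists>n. x \<in> spike n")
  case True
  then obtain n where x: "x \<in> spike n" by blast
  have "indicator (spike m) x = (0::ennreal)" if "m \<noteq> n" for m
    using x spike_disjoint[OF that] by (auto simp: indicator_def)
  then have "(\<Sum>m. ennreal (height m powr p) * indicator (spike m) x)
      = (\<Sum>m\<in>{n}. ennreal (height m powr p) * indicator (spike m) x)"
    by (intro suminf_finite) auto
  with x height_pos[of n] show ?thesis by (simp add: X_on_spike)
qed (auto simp: X_off_spikes)

lemma energy_X:
  assumes [measurable]: "A \<in> sets lebesgue"
  shows "energy p A X = (\<Sum>n. ennreal (height n powr p) * emeasure lebesgue (spike n \<inter> A))"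
proof -
  have "energy p A X = (\<integral>\<^sup>+x. (\<Sum>n. ennreal (height n powr p) * indicator (spike n \<inter> A) x) \<partial>lebesgue)"
    unfolding energy_indicator[OF assms]
    by (intro nn_integral_cong) (auto simp: X_powr indicator_def)
  also have "\<dots> = (\<Sum>n. \<integral>\<^sup>+x. ennreal (height n powr p) * indicator (spike n \<inter> A) x \<partial>lebesgue)"
    by (intro nn_integral_suminf) measurable
  also have "\<dots> = (\<Sum>n. ennreal (height n powr p) * emeasure lebesgue (spike n \<inter> A))"
    by (intro suminf_cong nn_integral_cmult_indicator) measurable
  finally show ?thesis .
qed

text \<open>The energy of the \<open>n\<close>-th spike has rate \<open>h n + g n * r\<close> with \<open>r = 1 / p\<close>, up to the weight.\<close>

lemma spike_energy:
  assumes "0 < p"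
  shows "ennreal (height n powr p) * emeasure lebesgue (spike n)
    = ennreal (spike_const * offset n powr (real CARD('d) + (h n + g n * (1 / p)) * p) * (real n + 1) powr (-2 * p))"
proof -
  have "emeasure lebesgue (spike n) = ennreal (unit_ball_vol (real CARD('d)) * radius n ^ CARD('d))"
    unfolding spike_def using radius(1)[of n] by (intro emeasure_ball_cart) simp
  also have "radius n ^ CARD('d) = offset n powr (real CARD('d) + g n) / 4 ^ CARD('d)"
  proof -
    have "(offset n powr (1 + g n / real CARD('d))) ^ CARD('d)
        = (offset n powr (1 + g n / real CARD('d))) powr real CARD('d)"
      using offset[of n] by (simp add: powr_realpow)
    also have "\<dots> = offset n powr (real CARD('d) + g n)"
      unfolding powr_powr by (simp add: distrib_right)
    finally show ?thesis by (simp add: radius_def power_divide)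
  qed
  finally have "emeasure lebesgue (spike n) = ennreal (spike_const * offset n powr (real CARD('d) + g n))"
    by (simp add: spike_const_def)
  moreover have "height n powr p = offset n powr (h n * p) * (real n + 1) powr (-2 * p)"
    unfolding height_def using offset[of n] by (subst powr_mult) (simp_all only: powr_powr)
  moreover have "offset n powr (h n * p) * offset n powr (real CARD('d) + g n)
      = offset n powr (real CARD('d) + (h n + g n * (1 / p)) * p)"
    unfolding powr_add[symmetric] using assms by (simp add: algebra_simps)
  ultimately show ?thesis
    using spike_const_pos by (simp add: mult_ac flip: ennreal_mult)
qed

lemma summable_weights: "summable (\<lambda>n. (real n + 1) powr (-2))"
proof -
  have "summable (\<lambda>n. real (Suc n) powr (-2))"
    using summable_Suc_iff[of "\<lambda>n. real n powr (-2)"] by (simp add: summable_real_powr_iff)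
  then show ?thesis by (simp add: add.commute)
qed

definition sum_const :: real where
  "sum_const = spike_const * (\<Sum>n. (real n + 1) powr (-2))"

lemma sum_const_nonneg: "0 \<le> sum_const"
  unfolding sum_const_def using spike_const_pos
  by (intro mult_nonneg_nonneg suminf_nonneg summable_weights) auto

text \<open>Since \<open>d + \<alpha> * p \<ge> 0\<close>, the energies of the spikes meeting \<open>A\<close> are bounded by
  \<open>b powr (d + \<alpha> * p)\<close> times the weights. The sum converges even if this exponent is \<open>0\<close>.\<close>

lemma energy_X_le:
  assumes p: "1 \<le> p" and A: "A \<in> sets lebesgue" and b: "0 < b" and \<alpha>: "- (real CARD('d) / p) \<le> \<alpha>"
    and meets: "\<And>n. spike n \<inter> A \<noteq> {} \<Longrightarrow> offset n \<le> b \<and> \<alpha> \<le> h n + g n * (1 / p)"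
  shows "energy p A X \<le> ennreal (sum_const * b powr (real CARD('d) + \<alpha> * p))"
proof -
  let ?e = "real CARD('d) + \<alpha> * p"
  have e: "0 \<le> ?e"
  proof -
    have "- (real CARD('d) / p) * p \<le> \<alpha> * p" using \<alpha> p by (intro mult_right_mono) auto
    then show ?thesis using p by simp
  qed
  have term_le: "ennreal (height n powr p) * emeasure lebesgue (spike n \<inter> A)
      \<le> ennreal (spike_const * b powr ?e * (real n + 1) powr (-2))" for n
  proof (cases "spike n \<inter> A = {}")
    case False
    have "ennreal (height n powr p) * emeasure lebesgue (spike n \<inter> A)
        \<le> ennreal (height n powr p) * emeasure lebesgue (spike n)"
      using spike_sets[of n] A by (intro mult_left_mono emeasure_mono) auto
    also have "\<dots> = ennreal (spike_const * offset n powr (real CARD('d) + (h n + g n * (1 / p)) * p)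
        * (real n + 1) powr (-2 * p))"
      using p by (intro spike_energy) simp
    also have "\<dots> \<le> ennreal (spike_const * b powr ?e * (real n + 1) powr (-2))"
    proof (intro ennreal_leI mult_mono mult_left_mono)
      have "offset n powr (real CARD('d) + (h n + g n * (1 / p)) * p) \<le> offset n powr ?e"
        using meets[OF False] p offset[of n] by (intro powr_mono' add_left_mono mult_right_mono) auto
      also have "\<dots> \<le> b powr ?e"
        using meets[OF False] e offset[of n] by (intro powr_mono2) auto
      finally show "offset n powr (real CARD('d) + (h n + g n * (1 / p)) * p) \<le> b powr ?e" .
      show "(real n + 1) powr (-2 * p) \<le> (real n + 1) powr (-2)"
        using p by (intro powr_mono) auto
    qed (use spike_const_pos in auto)
    finally show ?thesis .
  qed auto
  have sum: "summable (\<lambda>n. spike_const * b powr ?e * (real n + 1) powr (-2))"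
    by (intro summable_mult summable_weights)
  have "energy p A X \<le> (\<Sum>n. ennreal (spike_const * b powr ?e * (real n + 1) powr (-2)))"
    unfolding energy_X[OF A] by (intro suminf_le term_le summableI)
  also have "\<dots> = ennreal (\<Sum>n. spike_const * b powr ?e * (real n + 1) powr (-2))"
    using spike_const_pos by (intro suminf_ennreal2 sum) auto
  also have "(\<Sum>n. spike_const * b powr ?e * (real n + 1) powr (-2)) = sum_const * b powr ?e"
    unfolding sum_const_def by (subst suminf_mult[OF summable_weights]) simp
  finally show ?thesis .
qed

lemma X_measurable_on [measurable]: "X \<in> borel_measurable (lebesgue_on A)"
  by (rule measurable_restrict_space1) (rule X_measurable)

lemma X_in_Lp:
  assumes p: "1 \<le> p" and le: "\<And>n. - (real CARD('d) / p) \<le> h n + g n * (1 / p)"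
  shows "X \<in> Lp (ereal p) UNIV"
proof -
  have "energy p UNIV X \<le> ennreal (sum_const * 1 powr (real CARD('d) + - (real CARD('d) / p) * p))"
    using le offset by (intro energy_X_le p) auto
  then have "energy p UNIV X < \<infinity>" by (rule le_less_trans) simp
  moreover have "(\<lambda>x. \<bar>X x\<bar> powr p) \<in> borel_measurable (lebesgue_on UNIV)"
    using X_measurable_on[of UNIV] by measurable
  ultimately have "integrable (lebesgue_on UNIV) (\<lambda>x. \<bar>X x\<bar> powr p)"
    unfolding integrable_iff_bounded energy_def by simp
  then show ?thesis using X_measurable_on[of UNIV] by (simp add: Lp_def)
qed

lemma X_decays:
  assumes p: "1 \<le> p" and \<alpha>: "- (real CARD('d) / p) \<le> \<alpha>"
    and ev: "\<forall>\<^sub>F n in sequentially. \<alpha> \<le> h n + g n * (1 / p)"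
  shows "decays (ereal p) \<alpha> x0 X"
proof -
  from ev obtain N where N: "\<And>n. N \<le> n \<Longrightarrow> \<alpha> \<le> h n + g n * (1 / p)"
    unfolding eventually_sequentially by blast
  show ?thesis
  proof (rule decaysI_real[of "sum_const * 2 powr (real CARD('d) + \<alpha> * p)"])
    show "0 \<le> sum_const * 2 powr (real CARD('d) + \<alpha> * p)" using sum_const_nonneg by simp
    have "0 < offset N / 2" using offset[of N] by simp
    from eventually_at_right_small[OF this]
    show "\<forall>\<^sub>F a in at_right 0. X \<in> borel_measurable (lebesgue_on (ball x0 a)) \<and> energy p (ball x0 a) X
        \<le> ennreal (sum_const * 2 powr (real CARD('d) + \<alpha> * p) * a powr (real CARD('d) + \<alpha> * p))"
    proof eventually_elim
      case (elim a)
      have "offset n \<le> 2 * a \<and> \<alpha> \<le> h n + g n * (1 / p)" if meets: "spike n \<inter> ball x0 a \<noteq> {}" for n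
      proof -
        from meets obtain x where "x \<in> spike n" "norm (x - x0) < a"
          by (auto simp: dist_norm norm_minus_commute)
        then have n: "offset n < 2 * a" using spike_bounds(3)[of x n] by simp
        have "N \<le> n"
        proof (rule ccontr)
          assume "\<not> N \<le> n"
          then have "offset N \<le> offset n" by (intro offset_antimono) simp
          with n elim show False by simp
        qed
        with n N show ?thesis by simp
      qed
      then have "energy p (ball x0 a) X \<le> ennreal (sum_const * (2 * a) powr (real CARD('d) + \<alpha> * p))"
        using elim by (intro energy_X_le p \<alpha>) auto
      also have "(2 * a) powr (real CARD('d) + \<alpha> * p)
          = 2 powr (real CARD('d) + \<alpha> * p) * a powr (real CARD('d) + \<alpha> * p)"
        using elim by (simp add: powr_mult)
      finally show ?case by (simp add: mult.assoc)
    qed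
  qed
qed

text \<open>On the half space without spikes \<open>X - P = - P\<close>, so that a polynomial of degree less than
  \<open>\<alpha>\<close> approximating \<open>X\<close> at rate \<open>\<alpha>\<close> must vanish. Then the energy of a single spike bounds \<open>\<alpha>\<close>: in the
  limit along those \<open>n\<close> with rate at most \<open>c\<close>, the polynomial weight is negligible against the power
  \<open>(\<alpha> - c) * p\<close> of \<open>offset n\<close>.\<close>

lemma X_rate_le:
  assumes p: "1 \<le> p" and T: "X \<in> T_space (ereal p) \<alpha> x0"
    and freq: "\<exists>\<^sub>F n in sequentially. h n + g n * (1 / p) \<le> c"
  shows "\<alpha> \<le> c"
proof (rule ccontr)
  let ?d = "real CARD('d)"
  assume "\<not> \<alpha> \<le> c"
  then have c: "c < \<alpha>" by simp
  obtain P where P: "P \<in> polys_deg_less \<alpha>" "decays (ereal p) \<alpha> x0 (\<lambda>x. X x - P x)"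
    using T p by (auto simp: T_space_iff_real)
  obtain C where C: "C \<ge> 0" "\<forall>\<^sub>F a in at_right 0. (\<lambda>x. X x - P x) \<in> borel_measurable (lebesgue_on (ball x0 a)) \<and>
    energy p (ball x0 a) (\<lambda>x. X x - P x) \<le> ennreal (C * a powr (?d + \<alpha> * p))"
    using P(2) by (rule decaysE_real)
  define U where "U = {x. x0 $ i < x $ i}"
  have U: "U \<in> sets lebesgue"
    unfolding U_def by (auto intro!: borel_open open_Collect_less continuous_intros)
  have "\<forall>\<^sub>F a in at_right 0. energy p (ball x0 a \<inter> U) P \<le> ennreal (C * a powr (?d + \<alpha> * p))"
    using C(2)
  proof eventually_elim
    case (elim a)
    have "X x = 0" if "x \<in> U" for x
      using that spike_bounds(1)[of x] by (intro X_off_spikes) (force simp: U_def)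
    then have "energy p (ball x0 a \<inter> U) P = energy p (ball x0 a \<inter> U) (\<lambda>x. X x - P x)"
      unfolding energy_def by (intro nn_integral_cong) (auto simp: space_restrict_space)
    also have "\<dots> \<le> energy p (ball x0 a) (\<lambda>x. X x - P x)"
      using U by (intro energy_mono) auto
    finally show ?case using elim by (auto intro: order_trans)
  qed
  then have "\<exists>k. \<forall>x. P x = (\<Sum>m | real (mdeg m) < \<alpha> \<and> \<alpha> \<le> real (mdeg m). k m * monomial m (x - x0))"
    unfolding U_def using p by (intro polys_low_degree_part_vanishes[OF P(1)]) auto
  moreover have "{m :: 'd \<Rightarrow> nat. real (mdeg m) < \<alpha> \<and> \<alpha> \<le> real (mdeg m)} = {}" by auto
  ultimately have P0: "P x = 0" for x by simp
  have "filterlim (\<lambda>n. 2 * offset n) (at_right 0) sequentially"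
    unfolding offset_def by real_asymp
  from eventually_compose_filterlim[OF C(2) this]
  have ev: "\<forall>\<^sub>F n in sequentially. energy p (ball x0 (2 * offset n)) X
      \<le> ennreal (C * (2 * offset n) powr (?d + \<alpha> * p))"
    by eventually_elim (simp add: P0)
  define K where "K = C * 2 powr (?d + \<alpha> * p)"
  define e where "e = (\<alpha> - c) * p"
  have e: "e > 0" using c p by (simp add: e_def)
  have "(\<lambda>n. K * ((1 / 2) ^ n) powr e * (real n + 1) powr (2 * p)) \<longlonglongrightarrow> 0"
    using e by real_asymp
  then have "\<forall>\<^sub>F n in sequentially. K * offset n powr e * (real n + 1) powr (2 * p) < spike_const"
    unfolding offset_def using spike_const_pos by (rule order_tendstoD)
  with ev have "\<forall>\<^sub>F n in sequentially. \<not> h n + g n * (1 / p) \<le> c"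
  proof eventually_elim
    case (elim n)
    show ?case
    proof
      assume le: "h n + g n * (1 / p) \<le> c"
      have "ennreal (spike_const * offset n powr (?d + (h n + g n * (1 / p)) * p) * (real n + 1) powr (-2 * p))
          = ennreal (height n powr p) * emeasure lebesgue (spike n)"
        using p by (intro spike_energy[symmetric]) simp
      also have "\<dots> \<le> energy p (ball x0 (2 * offset n)) X"
        using spike_bounds(2)[of _ n] height_pos[of n] p spike_sets[of n]
        by (intro energy_ge) (auto simp: X_on_spike dist_norm norm_minus_commute)
      also have "\<dots> \<le> ennreal (C * (2 * offset n) powr (?d + \<alpha> * p))" by (rule elim)
      finally have "spike_const * offset n powr (?d + (h n + g n * (1 / p)) * p) * (real n + 1) powr (-2 * p)
          \<le> C * (2 * offset n) powr (?d + \<alpha> * p)"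
        using C(1) by (subst (asm) ennreal_le_iff) auto
      also have "\<dots> = K * offset n powr e * offset n powr (?d + c * p)"
        using offset[of n] unfolding K_def e_def
        by (simp add: powr_mult mult.assoc algebra_simps flip: powr_add)
      finally have "spike_const * offset n powr (?d + (h n + g n * (1 / p)) * p) * (real n + 1) powr (-2 * p)
          \<le> K * offset n powr e * offset n powr (?d + c * p)" .
      moreover have "spike_const * offset n powr (?d + c * p) * (real n + 1) powr (-2 * p)
          \<le> spike_const * offset n powr (?d + (h n + g n * (1 / p)) * p) * (real n + 1) powr (-2 * p)"
        using le p offset[of n] spike_const_pos
        by (intro mult_right_mono mult_left_mono powr_mono' add_left_mono) auto
      ultimately have "spike_const * (real n + 1) powr (-2 * p) * offset n powr (?d + c * p)
          \<le> K * offset n powr e * offset n powr (?d + c * p)" by (simp add: mult_ac)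
      then have "spike_const * (real n + 1) powr (-2 * p) \<le> K * offset n powr e"
        using offset[of n] by simp
      then have "spike_const * (real n + 1) powr (-2 * p) * (real n + 1) powr (2 * p)
          \<le> K * offset n powr e * (real n + 1) powr (2 * p)" by (intro mult_right_mono) auto
      then have "spike_const \<le> K * offset n powr e * (real n + 1) powr (2 * p)"
        by (simp add: mult.assoc flip: powr_add)
      with elim(2) show False by simp
    qed
  qed
  with freq show False by (simp add: frequently_def)
qed

end

text \<open>By \<open>X_decays\<close> and \<open>X_rate_le\<close> the exponent of the spike function at \<open>p\<close> is the lower limit of
  \<open>h n + g n * (1 / p)\<close>, which is chosen to be \<open>\<phi> p\<close>.\<close>

lemma exponent_realization:
  fixes x0 :: "real ^ 'd" and \<phi> :: "real \<Rightarrow> ereal"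
  assumes p0: "1 < p0" and ge: "\<And>p. p \<in> {1..p0} \<Longrightarrow> - (ereal (real CARD('d)) / ereal p0) \<le> \<phi> p"
    and anti: "antimono_on {1..p0} \<phi>" and conc: "concave_on_ereal {1 / p0..1} (\<lambda>r. \<phi> (1 / r))"
  shows "\<exists>X \<in> Lp (ereal p0) UNIV. \<forall>p\<in>{1..p0}. p_exponent (ereal p) x0 X = \<phi> p"
proof -
  define b where "b = - (real CARD('d) / p0)"
  have b: "- (ereal (real CARD('d)) / ereal p0) = ereal b" using p0 by (simp add: b_def)
  have inv: "1 / r \<in> {1..p0}" if "r \<in> {1 / p0..1}" for r
  proof -
    have "0 < r" using that p0 by (auto intro: less_le_trans[of 0 "1 / p0"])
    then show ?thesis using that p0 by (auto simp: field_simps)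
  qed
  have mono: "mono_on {1 / p0..1} (\<lambda>r. \<phi> (1 / r))"
  proof (rule mono_onI)
    fix r r' assume rr: "r \<in> {1 / p0..1}" "r' \<in> {1 / p0..1}" "r \<le> r'"
    have "0 < r" using rr(1) p0 by (auto intro: less_le_trans[of 0 "1 / p0"])
    then have "1 / r' \<le> 1 / r" using rr(3) by (intro divide_left_mono) auto
    then show "\<phi> (1 / r) \<le> \<phi> (1 / r')" using monotone_onD[OF anti inv[OF rr(2)] inv[OF rr(1)]] by simp
  qed
  have b0: "b \<le> 0" "1 / p0 < 1" using p0 by (simp_all add: b_def)
  have bge: "ereal b \<le> \<phi> (1 / r)" if "r \<in> {1 / p0..1}" for r
    using ge[OF inv[OF that]] unfolding b .
  from concave_is_liminf_of_affine[OF b0(2) conc mono b0(1) bge]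
  obtain h g :: "nat \<Rightarrow> real" where g: "\<And>n. 0 \<le> g n" and hb: "\<And>n. b \<le> h n + g n * (1 / p0)"
    and ev: "\<And>r \<alpha>. r \<in> {1 / p0..1} \<Longrightarrow> ereal \<alpha> < \<phi> (1 / r) \<Longrightarrow> \<forall>\<^sub>F n in sequentially. \<alpha> \<le> h n + g n * r"
    and freq: "\<And>r. r \<in> {1 / p0..1} \<Longrightarrow> \<exists>\<^sub>F n in sequentially. ereal (h n + g n * r) \<le> \<phi> (1 / r)"
    by blast
  interpret spikes x0 undefined h g by standard (rule g)
  have XLp: "X \<in> Lp (ereal p0) UNIV"
    using p0 hb by (intro X_in_Lp) (auto simp: b_def)
  then have X0: "X \<in> Lp_near (ereal p0) x0" unfolding Lp_near_def by blast
  have "p_exponent (ereal p) x0 X = \<phi> p" if p: "p \<in> {1..p0}" for p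
  proof (rule antisym)
    have r: "1 / p \<in> {1 / p0..1}" using p by (auto simp: field_simps)
    have Xp: "X \<in> Lp_near (ereal p) x0" using X0 p by (rule_tac Lp_near_antimono) auto
    have low: "ereal b \<le> \<phi> p" using bge[OF r] by simp
    show "p_exponent (ereal p) x0 X \<le> \<phi> p"
      unfolding p_exponent_def
    proof (rule Sup_least, clarify)
      fix \<alpha> assume T: "X \<in> T_space (ereal p) \<alpha> x0"
      show "ereal \<alpha> \<le> \<phi> p"
      proof (cases "\<phi> p")
        case (real c)
        have "\<exists>\<^sub>F n in sequentially. h n + g n * (1 / p) \<le> c" using freq[OF r] real by simp
        then have "\<alpha> \<le> c" using p by (intro X_rate_le[OF _ T]) auto
        with real show ?thesis by simp
      qed (use low in auto)
    qed
    show "\<phi> p \<le> p_exponent (ereal p) x0 X"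
    proof (rule dense_le)
      fix z assume z: "z < \<phi> p"
      have lower: "ereal (- (real CARD('d) / p)) \<le> p_exponent (ereal p) x0 X"
        using p_exponent_lower_bound[OF Xp] p by simp
      show "z \<le> p_exponent (ereal p) x0 X"
      proof (cases z)
        case (real \<alpha>)
        show ?thesis
        proof (cases "- (real CARD('d) / p) \<le> \<alpha>")
          case True
          have "decays (ereal p) \<alpha> x0 X"
            using ev[OF r, of \<alpha>] z real p by (intro X_decays True) auto
          then have "X \<in> T_space (ereal p) \<alpha> x0"
            using p zero_in_polys by (auto simp: T_space_iff_real intro!: bexI[of _ "\<lambda>x. 0"])
          then show ?thesis using True p real by (auto intro!: p_exponent_upper)
        next
          case False
          then have "z \<le> ereal (- (real CARD('d) / p))" using real by simp
          then show ?thesis using lower by (rule order_trans)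
        qed
      qed (use z in auto)
    qed
  qed
  with XLp show ?thesis by blast
qed

theorem theorem1:
  fixes x0 :: "real ^ 'd"
  shows
    "(\<forall>X \<in> L1_loc.
        let p0 = critical_exponent x0 X; D = exponent_domain x0 X; h = (\<lambda>p. p_exponent p x0 X) in
          p0 \<in> {1..\<infinity>} \<and>
          D = {1..<p0} \<union> (if X \<in> Lp_near p0 x0 then {p0} else {}) \<and>
          (\<forall>p\<in>D. h p \<in> {- (ereal (real CARD('d)) / p0)..\<infinity>}) \<and>
          antimono_on D h \<and>
          concave_on_ereal {r \<in> {0..1}. 1 / ereal r \<in> D} (\<lambda>r. h (1 / ereal r)))
     \<and>
     (\<forall>(p0 :: real) (\<phi> :: real \<Rightarrow> ereal).
        1 < p0 \<and>
        (\<forall>p\<in>{1..p0}. \<phi> p \<in> {- (ereal (real CARD('d)) / ereal p0)..\<infinity>}) \<and>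
        antimono_on {1..p0} \<phi> \<and>
        concave_on_ereal {1 / p0..1} (\<lambda>r. \<phi> (1 / r)) \<longrightarrow>
        (\<exists>X \<in> Lp (ereal p0) UNIV. \<forall>p\<in>{1..p0}. p_exponent (ereal p) x0 X = \<phi> p))"
proof (intro conjI ballI allI impI)
  fix X :: "real ^ 'd \<Rightarrow> real" assume X: "X \<in> L1_loc"
  show "let p0 = critical_exponent x0 X; D = exponent_domain x0 X; h = (\<lambda>p. p_exponent p x0 X) in
          p0 \<in> {1..\<infinity>} \<and>
          D = {1..<p0} \<union> (if X \<in> Lp_near p0 x0 then {p0} else {}) \<and>
          (\<forall>p\<in>D. h p \<in> {- (ereal (real CARD('d)) / p0)..\<infinity>}) \<and>
          antimono_on D h \<and>
          concave_on_ereal {r \<in> {0..1}. 1 / ereal r \<in> D} (\<lambda>r. h (1 / ereal r))"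
    unfolding Let_def
  proof (intro conjI)
    show "critical_exponent x0 X \<in> {1..\<infinity>}"
      using exponent_domain_eq(2)[OF X, of x0] by simp
    show "exponent_domain x0 X = {1..<critical_exponent x0 X} \<union>
        (if X \<in> Lp_near (critical_exponent x0 X) x0 then {critical_exponent x0 X} else {})"
      by (rule exponent_domain_eq(1)[OF X])
    show "\<forall>p\<in>exponent_domain x0 X.
        p_exponent p x0 X \<in> {- (ereal (real CARD('d)) / critical_exponent x0 X)..\<infinity>}"
      using p_exponent_ge_critical[of _ x0 X] by simp
    show "antimono_on (exponent_domain x0 X) (\<lambda>p. p_exponent p x0 X)"
      by (rule monotone_onI) (simp add: p_exponent_antimono exponent_domain_def)
    show "concave_on_ereal {r \<in> {0..1}. 1 / ereal r \<in> exponent_domain x0 X}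
        (\<lambda>r. p_exponent (1 / ereal r) x0 X)"
      by (rule p_exponent_concave)
  qed
next
  fix p0 :: real and \<phi> :: "real \<Rightarrow> ereal"
  assume *: "1 < p0 \<and>
        (\<forall>p\<in>{1..p0}. \<phi> p \<in> {- (ereal (real CARD('d)) / ereal p0)..\<infinity>}) \<and>
        antimono_on {1..p0} \<phi> \<and>
        concave_on_ereal {1 / p0..1} (\<lambda>r. \<phi> (1 / r))"
  show "\<exists>X \<in> Lp (ereal p0) UNIV. \<forall>p\<in>{1..p0}. p_exponent (ereal p) x0 X = \<phi> p"
    by (rule exponent_realization) (use * in auto)
qed

end
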